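(* For any pair of positive integers $(n,m)$ with $n+1\leq m\leq 2n+1$, there is an integrally closed integral domain $R$ such that $w\text{-}\dim(R)=n$ and $w[X]\text{-}\dim(R[X])=m$.
   Context: All rings are commutative integral domains with identity; $qf(R)$ is the quotient field of $R$. $F(R)$ denotes the set of nonzero fractional ideals of $R$ and $f(R)$ the set of nonzero finitely generated fractional ideals. For $A\in F(R)$ put $A^{-1}=\{x\in qf(R): xA\subseteq R\}$, $A^v=(A^{-1})^{-1}$, and $A^w=\{x\in qf(R): xJ\subseteq A \text{ for some } J\subseteq R,\ J\in f(R),\ J^v=R\}$; $w:A\mapsto A^w$ is a star operation on $R$. For a star operation $*$ on a domain $R$, a $*$-prime ideal is a nonzero prime ideal $P$ with $P^*=P$, and $*\text{-}\dim(R)=\sup\{n : P_1\subsetneq\cdots\subsetneq P_n,\ P_i \text{ } *\text{-prime ideals of } R\}$, with value $0$ if there are no $*$-prime ideals. The star operation $w[X]$ on $R[X]$: let $X,Y$ be indeterminates over $R$, $K=qf(R)$, $R_1=R[X]$, $K_1=K(X)$. Put $\Theta_1^w=\{Q_1\in\operatorname{Spec}(R_1) : Q_1\cap R=(0)\text{ or }(Q_1\cap R)^w\subsetneq R\}$ and $\mathfrak{S}_1^w=R_1[Y]\setminus\bigcup\{Q_1[Y] : Q_1\in\Theta_1^w\}$. For $E\in F(R_1)$ define $E^{w[X]}=E[Y]_{\mathfrak{S}_1^w}\cap K_1$. It is known that $w[X]$ is a star operation on $R[X]$. *)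

theory Defs
  imports Complex_Main
    "HOL-Library.Extended_Nat"
    "HOL-Computational_Algebra.Computational_Algebra"
begin

text \<open>
  An integral domain is represented as a unital subring of an ambient field, and its quotient
  field is formed inside the same field; every domain arises this way, by taking its own quotient
  field as the ambient one. This makes it possible to quantify over domains inside a formula and
  lets the same definitions apply to \<open>R\<close> and to \<open>R[X]\<close>.
\<close>

definition is_subring :: "'a::field set \<Rightarrow> bool" where
  "is_subring R \<longleftrightarrow> 1 \<in> R \<and> (\<forall>x\<in>R. \<forall>y\<in>R. x - y \<in> R \<and> x * y \<in> R)"

definition qf :: "'a::field set \<Rightarrow> 'a set" where
  "qf R = {a / b | a b. a \<in> R \<and> b \<in> R \<and> b \<noteq> 0}"

definition polys_over :: "'a::zero set \<Rightarrow> 'a poly set" where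
  "polys_over E = {p. \<forall>i. coeff p i \<in> E}"

definition integrally_closed :: "'a::field set \<Rightarrow> bool" where
  "integrally_closed R \<longleftrightarrow>
     (\<forall>x\<in>qf R. (\<exists>p\<in>polys_over R. lead_coeff p = 1 \<and> poly p x = 0) \<longrightarrow> x \<in> R)"


definition is_submodule :: "'a::field set \<Rightarrow> 'a set \<Rightarrow> bool" where
  "is_submodule R A \<longleftrightarrow> 0 \<in> A \<and> (\<forall>x\<in>A. \<forall>y\<in>A. x + y \<in> A) \<and> (\<forall>r\<in>R. \<forall>x\<in>A. r * x \<in> A)"

definition frac_ideals :: "'a::field set \<Rightarrow> 'a set set" where
  "frac_ideals R = {A. is_submodule R A \<and> A \<subseteq> qf R \<and> A \<noteq> {0} \<and>
     (\<exists>d\<in>R. d \<noteq> 0 \<and> (\<forall>x\<in>A. d * x \<in> R))}"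

definition fg_frac_ideals :: "'a::field set \<Rightarrow> 'a set set" where
  "fg_frac_ideals R = {A \<in> frac_ideals R.
     \<exists>S. finite S \<and> A = {(\<Sum>s\<in>S. c s * s) | c. \<forall>s\<in>S. c s \<in> R}}"

definition ideal_inv :: "'a::field set \<Rightarrow> 'a set \<Rightarrow> 'a set" where
  "ideal_inv R A = {x \<in> qf R. \<forall>a\<in>A. x * a \<in> R}"

definition v_op :: "'a::field set \<Rightarrow> 'a set \<Rightarrow> 'a set" where
  "v_op R A = ideal_inv R (ideal_inv R A)"

definition w_op :: "'a::field set \<Rightarrow> 'a set \<Rightarrow> 'a set" where
  "w_op R A = {x \<in> qf R. \<exists>J. J \<subseteq> R \<and> J \<in> fg_frac_ideals R \<and> v_op R J = R \<and> (\<forall>j\<in>J. x * j \<in> A)}"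


definition prime_spectrum :: "'a::field set \<Rightarrow> 'a set set" where
  "prime_spectrum R = {P. is_submodule R P \<and> P \<subset> R \<and>
     (\<forall>x\<in>R. \<forall>y\<in>R. x * y \<in> P \<longrightarrow> x \<in> P \<or> y \<in> P)}"

definition star_primes :: "('a::field set \<Rightarrow> 'a set) \<Rightarrow> 'a set \<Rightarrow> 'a set set" where
  "star_primes star R = {P \<in> prime_spectrum R. P \<noteq> {0} \<and> star P = P}"

text \<open>The length of a chain is its number of members; the empty chain yields the value 0 when
  there are no star-primes.\<close>

definition star_dim :: "('a::field set \<Rightarrow> 'a set) \<Rightarrow> 'a set \<Rightarrow> enat" where
  "star_dim star R =
     Sup {enat (length Ps) | Ps. set Ps \<subseteq> star_primes star R \<and> sorted_wrt (\<subset>) Ps}"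


text \<open>\<open>R[X]\<close> as a subring of the field of rational functions in \<open>X\<close> over the ambient field of \<open>R\<close>;
  \<open>qf (poly_ring R)\<close> is then \<open>K(X)\<close>, where \<open>K = qf R\<close>.\<close>

definition poly_ring :: "'a::field set \<Rightarrow> 'a poly fract set" where
  "poly_ring R = to_fract ` polys_over R"

definition contraction :: "'a::field set \<Rightarrow> 'a poly fract set \<Rightarrow> 'a set" where
  "contraction R Q = {r \<in> R. to_fract [:r:] \<in> Q}"

definition Theta_w :: "'a::field set \<Rightarrow> 'a poly fract set set" where
  "Theta_w R = {Q \<in> prime_spectrum (poly_ring R).
     contraction R Q = {0} \<or> w_op R (contraction R Q) \<subset> R}"

text \<open>Polynomials in \<open>Y\<close> with coefficients in \<open>E\<close> are \<open>polys_over E\<close>, for \<open>E\<close> a set of rational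
  functions in \<open>X\<close>.\<close>

definition S_w :: "'a::field set \<Rightarrow> 'a poly fract poly set" where
  "S_w R = polys_over (poly_ring R) - (\<Union>Q\<in>Theta_w R. polys_over Q)"

definition localize :: "'b::idom set \<Rightarrow> 'b set \<Rightarrow> 'b fract set" where
  "localize M S = {to_fract f / to_fract s | f s. f \<in> M \<and> s \<in> S}"

text \<open>Intersecting with \<open>K(X)\<close> takes place in the field of rational functions in \<open>Y\<close>, into which
  \<open>K(X)\<close> embeds as constants.\<close>

definition wX_op :: "'a::field set \<Rightarrow> 'a poly fract set \<Rightarrow> 'a poly fract set" where
  "wX_op R E = {x \<in> qf (poly_ring R). to_fract [:x:] \<in> localize (polys_over E) (S_w R)}"

end

theory Submission
  imports Defs "HOL-Analysis.Continuum_Not_Denumerable"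
begin

text \<open>
  The operations \<open>w\<close> and \<open>w[X]\<close> only see finitely generated ideals \<open>J\<close> with \<open>J\<^sup>v = R\<close>. If every proper
  nonzero ideal of \<open>R\<close> has an inverse larger than \<open>R\<close>, then \<open>J = R\<close> is the only such ideal, so
  every ideal is a \<open>w\<close>-ideal (\<open>w_op_ideal\<close>). Consequently \<open>Theta_w R\<close> is the whole spectrum of
  \<open>R[X]\<close>, the coefficients of a member of the multiplicative set generate the unit ideal, and every
  prime of \<open>R[X]\<close> is fixed by \<open>w[X]\<close> (\<open>wX_op_prime\<close>). For such an \<open>R\<close> the two star dimensions are
  the Krull dimensions of \<open>R\<close> and \<open>R[X]\<close>, and the theorem becomes a statement of Seidenberg's kind
  about integrally closed domains.
  
  Such domains are built upwards from the field of rational numbers, whose pair of dimensions is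
  \<open>(0, 1)\<close>. Given \<open>R\<close> inside a field \<open>K\<close>, choose a discrete valuation ring \<open>V = K[x]\<^sub>(\<^sub>x\<^sub>)\<close> with
  residue field \<open>K\<close> and let \<open>T\<close> consist of the elements of \<open>V\<close> whose residue lies in \<open>R\<close>. The maximal
  ideal \<open>M\<close> of \<open>V\<close> is a prime of \<open>T\<close> with \<open>T/M = R\<close>, and the only prime of \<open>T\<close> not containing it is
  \<open>0\<close>; so the dimension goes up by one (\<open>has_dim_pullback\<close>). A chain of primes of \<open>T[X]\<close> consists of
  at most two primes that meet \<open>T\<close> in \<open>0\<close>, followed by a chain that comes from \<open>R[X]\<close>; so the
  dimension of the polynomial ring goes up by at most two. Two choices of \<open>K\<close> are used.
  
  \<^item> If \<open>K\<close> is the quotient field of \<open>R\<close>, a nonzero prime lying over \<open>0\<close> contains a polynomial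
    that does not vanish modulo \<open>M\<close>. A chain that uses two primes over \<open>0\<close> therefore skips \<open>M[X]\<close>,
    and the dimension goes up by exactly one (\<open>has_dim_poly_same_field\<close>).
  \<^item> If \<open>K\<close> contains an element \<open>s\<close> transcendental over \<open>R\<close>, the polynomials vanishing at \<open>s\<close> form a
    prime strictly between \<open>0\<close> and \<open>M[X]\<close>, and the dimension goes up by exactly two
    (\<open>has_dim_poly_transcendental\<close>).
  
  In the second case \<open>K\<close> is a simple transcendental extension of the quotient field of \<open>R\<close>, which
  is algebraically closed in it (\<open>algebraic_in_K\<close>), so \<open>T\<close> stays integrally closed. After \<open>n\<close> steps, \<open>j\<close> of them of the
  second kind, the dimensions are \<open>n\<close> and \<open>n + 1 + j\<close>, and \<open>j\<close> may be any number up to \<open>n\<close>. All rings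
  are countable, so that the complex numbers always contain a further transcendental element.
\<close>

section \<open>Subrings, prime ideals and chains\<close>

text \<open>
  Subrings and ideals are needed in \<open>R\<close> and in \<open>R[X]\<close> alike, hence in ambient rings that need not be
  fields.
\<close>
definition subring_set :: "'a::comm_ring_1 set \<Rightarrow> bool" where
  "subring_set A \<longleftrightarrow> 1 \<in> A \<and> (\<forall>x\<in>A. \<forall>y\<in>A. x - y \<in> A \<and> x * y \<in> A)"

lemma is_subring_iff: "is_subring R \<longleftrightarrow> subring_set R"
  by (simp add: is_subring_def subring_set_def)

lemma subring_one: "subring_set A \<Longrightarrow> 1 \<in> A"
  and subring_diff: "subring_set A \<Longrightarrow> x \<in> A \<Longrightarrow> y \<in> A \<Longrightarrow> x - y \<in> A"
  and subring_mult: "subring_set A \<Longrightarrow> x \<in> A \<Longrightarrow> y \<in> A \<Longrightarrow> x * y \<in> A"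
  by (auto simp: subring_set_def)

lemma subring_zero: "subring_set A \<Longrightarrow> 0 \<in> A"
  using subring_diff[of A 1 1] by (simp add: subring_one)

lemma subring_uminus: "subring_set A \<Longrightarrow> x \<in> A \<Longrightarrow> - x \<in> A"
  using subring_diff[of A 0 x] by (simp add: subring_zero)

lemma subring_add: "subring_set A \<Longrightarrow> x \<in> A \<Longrightarrow> y \<in> A \<Longrightarrow> x + y \<in> A"
  using subring_diff[of A x "- y"] by (simp add: subring_uminus)

lemma subring_power: "subring_set A \<Longrightarrow> x \<in> A \<Longrightarrow> x ^ k \<in> A"
  by (induction k) (auto simp: subring_one subring_mult)

lemma subring_sum: "subring_set A \<Longrightarrow> (\<And>i. i \<in> I \<Longrightarrow> f i \<in> A) \<Longrightarrow> sum f I \<in> A"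
  by (induction I rule: infinite_finite_induct) (auto simp: subring_zero subring_add)

lemmas subring_closed = subring_one subring_zero subring_diff subring_mult subring_uminus
  subring_add subring_power subring_sum

lemma subring_polys_over: "subring_set A \<Longrightarrow> subring_set (polys_over A)"
  unfolding subring_set_def[of "polys_over A"]
  by (auto simp: polys_over_def coeff_mult subring_closed coeff_1)

lemma pCons_in_polys_over: "pCons a p \<in> polys_over E \<longleftrightarrow> a \<in> E \<and> p \<in> polys_over E"
  by (auto simp: polys_over_def coeff_pCons split: nat.splits)

lemma zero_in_polys_over: "0 \<in> polys_over E \<longleftrightarrow> 0 \<in> E"
  by (auto simp: polys_over_def)

lemma polys_over_mono: "E \<subseteq> F \<Longrightarrow> polys_over E \<subseteq> polys_over F"
  by (auto simp: polys_over_def)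

lemma smult_in_polys_over:
  "subring_set A \<Longrightarrow> c \<in> A \<Longrightarrow> p \<in> polys_over A \<Longrightarrow> smult c p \<in> polys_over A"
  by (simp add: polys_over_def subring_mult)

lemma poly_in_subring:
  "subring_set A \<Longrightarrow> p \<in> polys_over A \<Longrightarrow> c \<in> A \<Longrightarrow> poly p c \<in> A"
  by (induction p) (auto simp: pCons_in_polys_over subring_closed)

definition ideal_in :: "'a::comm_ring_1 set \<Rightarrow> 'a set \<Rightarrow> bool" where
  "ideal_in A I \<longleftrightarrow> I \<subseteq> A \<and> 0 \<in> I \<and> (\<forall>x\<in>I. \<forall>y\<in>I. x + y \<in> I) \<and> (\<forall>r\<in>A. \<forall>x\<in>I. r * x \<in> I)"

definition prime_in :: "'a::comm_ring_1 set \<Rightarrow> 'a set \<Rightarrow> bool" where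
  "prime_in A P \<longleftrightarrow> ideal_in A P \<and> 1 \<notin> P \<and>
     (\<forall>x\<in>A. \<forall>y\<in>A. x * y \<in> P \<longrightarrow> x \<in> P \<or> y \<in> P)"

lemma ideal_subset: "ideal_in A I \<Longrightarrow> I \<subseteq> A"
  and ideal_zero: "ideal_in A I \<Longrightarrow> 0 \<in> I"
  and ideal_add: "ideal_in A I \<Longrightarrow> x \<in> I \<Longrightarrow> y \<in> I \<Longrightarrow> x + y \<in> I"
  and ideal_mult: "ideal_in A I \<Longrightarrow> r \<in> A \<Longrightarrow> x \<in> I \<Longrightarrow> r * x \<in> I"
  by (auto simp: ideal_in_def)

lemma ideal_mem: "ideal_in A I \<Longrightarrow> x \<in> I \<Longrightarrow> x \<in> A"
  by (auto simp: ideal_in_def)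

lemma ideal_mult_right: "ideal_in A I \<Longrightarrow> r \<in> A \<Longrightarrow> x \<in> I \<Longrightarrow> x * r \<in> I"
  using ideal_mult[of A I r x] by (simp add: mult.commute)

lemma ideal_diff: "subring_set A \<Longrightarrow> ideal_in A I \<Longrightarrow> x \<in> I \<Longrightarrow> y \<in> I \<Longrightarrow> x - y \<in> I"
  using ideal_add[of A I x "-1 * y"] ideal_mult[of A I "-1" y]
  by (simp add: subring_closed)

lemma prime_ideal: "prime_in A P \<Longrightarrow> ideal_in A P"
  and prime_proper: "prime_in A P \<Longrightarrow> 1 \<notin> P"
  and prime_prod: "prime_in A P \<Longrightarrow> x \<in> A \<Longrightarrow> y \<in> A \<Longrightarrow> x * y \<in> P \<Longrightarrow> x \<in> P \<or> y \<in> P"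
  by (auto simp: prime_in_def)

lemma prime_power: "subring_set A \<Longrightarrow> prime_in A P \<Longrightarrow> x \<in> A \<Longrightarrow> x ^ k \<in> P \<Longrightarrow> x \<in> P"
proof (induction k)
  case (Suc k)
  then show ?case using prime_prod[of A P x "x ^ k"] by (auto simp: subring_power)
qed (simp add: prime_in_def)

lemma prime_zero:
  fixes A :: "'a::idom set"
  shows "subring_set A \<Longrightarrow> prime_in A {0}"
  by (auto simp: prime_in_def ideal_in_def subring_zero)

lemma ideal_one_iff: "ideal_in A I \<Longrightarrow> 1 \<in> I \<longleftrightarrow> I = A" if "subring_set A"
  using ideal_mult_right[of A I _ 1] that by (auto dest: ideal_subset simp: subring_one)

lemma prime_spectrum_iff:
  assumes "is_subring R"
  shows "P \<in> prime_spectrum R \<longleftrightarrow> prime_in R P"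
proof -
  have R: "subring_set R" using assms by (simp add: is_subring_iff)
  show ?thesis
    unfolding prime_spectrum_def prime_in_def is_submodule_def psubset_eq
    using ideal_one_iff[OF R, of P] by (auto simp: ideal_in_def)
qed

definition prime_chain :: "'a::comm_ring_1 set \<Rightarrow> 'a set list \<Rightarrow> bool" where
  "prime_chain A Ps \<longleftrightarrow> (\<forall>P\<in>set Ps. prime_in A P) \<and> sorted_wrt (\<subset>) Ps"

text \<open>
  The bound is \<open>Suc d\<close> because these chains may begin with the zero ideal, unlike chains of
  star-primes.
\<close>
definition has_dim :: "'a::comm_ring_1 set \<Rightarrow> nat \<Rightarrow> bool" where
  "has_dim A d \<longleftrightarrow> (\<exists>Ps. prime_chain A Ps \<and> length Ps = Suc d) \<and>
     (\<forall>Ps. prime_chain A Ps \<longrightarrow> length Ps \<le> Suc d)"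

lemma has_dimI:
  "prime_chain A Ps \<Longrightarrow> length Ps = Suc d \<Longrightarrow>
   (\<And>Qs. prime_chain A Qs \<Longrightarrow> length Qs \<le> Suc d) \<Longrightarrow> has_dim A d"
  by (auto simp: has_dim_def)

lemma has_dim_bound: "has_dim A d \<Longrightarrow> prime_chain A Ps \<Longrightarrow> length Ps \<le> Suc d"
  by (auto simp: has_dim_def)

lemma prime_chain_zero_Cons:
  fixes A :: "'a::idom set"
  assumes "subring_set A" "prime_chain A Ps" "\<And>P. P \<in> set Ps \<Longrightarrow> P \<noteq> {0}"
  shows "prime_chain A ({0} # Ps)"
proof -
  have "{0} \<subset> P" if "P \<in> set Ps" for P
  proof -
    have "0 \<in> P" using assms(2) that by (auto simp: prime_chain_def dest: prime_ideal ideal_zero)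
    then show ?thesis using assms(3)[OF that] by blast
  qed
  then show ?thesis using assms by (simp add: prime_chain_def prime_zero)
qed

lemma sorted_psubset_const:
  assumes "sorted_wrt (\<subset>) Ps" "\<And>P. P \<in> set Ps \<Longrightarrow> P = Z"
  shows "length Ps \<le> 1"
proof (cases Ps)
  case (Cons P Qs)
  then show ?thesis using assms by (cases Qs) auto
qed simp

text \<open>
  Containing \<open>I\<close> is inherited upwards, so a chain breaks into primes that do not contain \<open>I\<close>,
  followed by primes of the quotient by \<open>I\<close>.
\<close>
lemma chain_split:
  assumes "prime_chain A Ps"
  obtains Ls Hs where "Ps = Ls @ Hs" "prime_chain A Ls" "prime_chain A Hs"
    "\<And>P. P \<in> set Ls \<Longrightarrow> \<not> I \<subseteq> P" "\<And>P. P \<in> set Hs \<Longrightarrow> I \<subseteq> P"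
    "\<And>P Q. P \<in> set Ls \<Longrightarrow> Q \<in> set Hs \<Longrightarrow> P \<subset> Q"
proof -
  have "\<exists>Ls Hs. Ps = Ls @ Hs \<and> (\<forall>P\<in>set Ls. \<not> I \<subseteq> P) \<and> (\<forall>P\<in>set Hs. I \<subseteq> P)"
    if "sorted_wrt (\<subset>) Ps" for Ps :: "'a set list"
    using that
  proof (induction Ps)
    case (Cons P Ps)
    then obtain Ls Hs where LH: "Ps = Ls @ Hs" "\<forall>P\<in>set Ls. \<not> I \<subseteq> P" "\<forall>P\<in>set Hs. I \<subseteq> P"
      by auto
    show ?case
    proof (cases "I \<subseteq> P")
      case True
      then have "\<forall>Q\<in>set (P # Ps). I \<subseteq> Q" using Cons.prems by auto
      then show ?thesis by (intro exI[of _ "[]"] exI[of _ "P # Ps"]) simp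
    next
      case False
      then show ?thesis using LH by (intro exI[of _ "P # Ls"] exI[of _ Hs]) simp
    qed
  qed simp
  then obtain Ls Hs where "Ps = Ls @ Hs" "\<forall>P\<in>set Ls. \<not> I \<subseteq> P" "\<forall>P\<in>set Hs. I \<subseteq> P"
    using assms unfolding prime_chain_def by blast
  then show ?thesis
    using assms that[of Ls Hs] unfolding prime_chain_def by (auto simp: sorted_wrt_append)
qed

text \<open>
  Krull's theorem: an ideal that Zorn's lemma makes maximal among the proper ideals above \<open>I\<close> is prime.
\<close>
lemma exists_prime_above:
  assumes A: "subring_set A" and I: "ideal_in A I" "1 \<notin> I"
  shows "\<exists>P. prime_in A P \<and> I \<subseteq> P"
proof -
  define F where "F = {J. ideal_in A J \<and> 1 \<notin> J \<and> I \<subseteq> J}"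
  have "I \<in> F" using I by (simp add: F_def)
  have "\<Union>C \<in> F" if "C \<noteq> {}" "subset.chain F C" for C
  proof -
    have C: "J \<in> F" if "J \<in> C" for J using that \<open>subset.chain F C\<close> by (auto simp: subset.chain_def)
    have "x + y \<in> \<Union>C" if xy: "x \<in> \<Union>C" "y \<in> \<Union>C" for x y
    proof -
      obtain J1 J2 where J12: "J1 \<in> C" "x \<in> J1" "J2 \<in> C" "y \<in> J2" using xy by blast
      moreover have "J1 \<subseteq> J2 \<or> J2 \<subseteq> J1"
        using J12 \<open>subset.chain F C\<close> unfolding subset_chain_def by blast
      ultimately obtain J where "J \<in> C" "x \<in> J" "y \<in> J" by blast
      then show ?thesis using C[of J] by (auto simp: F_def dest: ideal_add)
    qed
    moreover have "r * x \<in> \<Union>C" if "r \<in> A" "x \<in> \<Union>C" for r x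
      using that C by (auto simp: F_def dest: ideal_mult)
    moreover obtain J where "J \<in> C" using \<open>C \<noteq> {}\<close> by blast
    then have "I \<subseteq> \<Union>C" "0 \<in> \<Union>C" using C[of J] by (auto simp: F_def dest: ideal_zero)
    moreover have "\<Union>C \<subseteq> A" "1 \<notin> \<Union>C" using C by (auto simp: F_def dest: ideal_subset)
    ultimately show ?thesis
      unfolding F_def ideal_in_def by (intro CollectI conjI ballI)
  qed
  then obtain M where M: "M \<in> F" "\<And>J. J \<in> F \<Longrightarrow> M \<subseteq> J \<Longrightarrow> J = M"
    using subset_Zorn_nonempty[of F] \<open>I \<in> F\<close> by blast
  then have Mi: "ideal_in A M" "1 \<notin> M" "I \<subseteq> M" by (auto simp: F_def)
  have unit: "\<exists>m\<in>M. \<exists>r\<in>A. 1 = m + r * a" if "a \<in> A" "a \<notin> M" for a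
  proof -
    define J where "J = {m + r * a | m r. m \<in> M \<and> r \<in> A}"
    have "m \<in> J" if "m \<in> M" for m
      unfolding J_def using that A
      by (intro CollectI exI[of _ m] exI[of _ "0 :: 'a"]) (simp add: subring_zero)
    moreover have "a \<in> J"
      unfolding J_def using ideal_zero[OF Mi(1)] A
      by (intro CollectI exI[of _ "0 :: 'a"] exI[of _ "1 :: 'a"]) (simp add: subring_one)
    moreover have "ideal_in A J"
      unfolding ideal_in_def
    proof (intro conjI ballI)
      show "J \<subseteq> A" using A \<open>a \<in> A\<close> by (auto simp: J_def subring_closed ideal_mem[OF Mi(1)])
      show "0 \<in> J" using \<open>\<And>m. m \<in> M \<Longrightarrow> m \<in> J\<close> Mi by (auto dest: ideal_zero)
    next
      fix x y assume "x \<in> J" "y \<in> J"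
      then obtain m r m' r' where "x = m + r * a" "y = m' + r' * a" "m \<in> M" "r \<in> A" "m' \<in> M" "r' \<in> A"
        by (auto simp: J_def)
      then show "x + y \<in> J" using Mi(1) A unfolding J_def
        by (intro CollectI exI[of _ "m + m'"] exI[of _ "r + r'"])
           (auto simp: algebra_simps ideal_add subring_add)
    next
      fix c x assume "c \<in> A" "x \<in> J"
      then obtain m r where "x = m + r * a" "m \<in> M" "r \<in> A" by (auto simp: J_def)
      then show "c * x \<in> J" using Mi(1) A \<open>c \<in> A\<close> unfolding J_def
        by (intro CollectI exI[of _ "c * m"] exI[of _ "c * r"])
           (auto simp: algebra_simps ideal_mult subring_mult)
    qed
    ultimately have "1 \<in> J" using M(2)[of J] Mi \<open>a \<notin> M\<close> unfolding F_def by blast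
    then show ?thesis by (auto simp: J_def)
  qed
  have "x \<in> M \<or> y \<in> M" if xy: "x \<in> A" "y \<in> A" "x * y \<in> M" for x y
  proof (rule ccontr)
    assume "\<not> (x \<in> M \<or> y \<in> M)"
    then obtain m r m' r' where
      *: "m \<in> M" "r \<in> A" "1 = m + r * x" "m' \<in> M" "r' \<in> A" "1 = m' + r' * y"
      using unit xy by metis
    have "1 = (m + r * x) * (m' + r' * y)" using *(3,6) by simp
    \<comment> \<open>Each summand of the product has a factor in \<open>M\<close>.\<close>
    also have "\<dots> = (m' + r' * y) * m + ((r * x) * m' + (r * r') * (x * y))"
      by (simp add: algebra_simps)
    also have "\<dots> \<in> M"
      using * xy A ideal_mult[OF Mi(1) _ xy(3), of "r * r'"]
      by (intro ideal_add[OF Mi(1)] ideal_mult[OF Mi(1) _ *(1)] ideal_mult[OF Mi(1) _ *(4)])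
        (auto simp: subring_closed ideal_mem[OF Mi(1)])
    finally show False using Mi by simp
  qed
  then show ?thesis using Mi by (auto simp: prime_in_def)
qed

section \<open>Primes and surjective homomorphisms\<close>

text \<open>
  The target serves as the quotient by the kernel. The laws are imposed on \<open>A\<close> only, because a residue map
  is meaningful only on its valuation ring.
\<close>
locale ring_surjection =
  fixes A :: "'a::comm_ring_1 set" and B :: "'b::comm_ring_1 set" and h :: "'a \<Rightarrow> 'b"
  assumes A: "subring_set A" and B: "subring_set B"
    and h_diff: "\<And>x y. x \<in> A \<Longrightarrow> y \<in> A \<Longrightarrow> h (x - y) = h x - h y"
    and h_mult: "\<And>x y. x \<in> A \<Longrightarrow> y \<in> A \<Longrightarrow> h (x * y) = h x * h y"
    and h_one: "h 1 = 1"
    and h_image: "h ` A = B"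
begin

definition ker :: "'a set" where "ker = {a \<in> A. h a = 0}"

definition pre :: "'b set \<Rightarrow> 'a set" where "pre Q = {a \<in> A. h a \<in> Q}"

lemma h_zero: "h 0 = 0"
  using h_diff[of 1 1] A by (simp add: subring_one)

lemma h_add: "x \<in> A \<Longrightarrow> y \<in> A \<Longrightarrow> h (x + y) = h x + h y"
  using h_diff[of x "0 - y"] h_diff[of 0 y] A by (simp add: h_zero subring_closed)

lemma h_in: "x \<in> A \<Longrightarrow> h x \<in> B"
  using h_image by blast

lemma prime_pre:
  assumes "prime_in B Q"
  shows "prime_in A (pre Q)"
proof -
  have Q: "0 \<in> Q" "1 \<notin> Q" "\<And>x y. x \<in> Q \<Longrightarrow> y \<in> Q \<Longrightarrow> x + y \<in> Q"
    "\<And>r x. r \<in> B \<Longrightarrow> x \<in> Q \<Longrightarrow> r * x \<in> Q"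
    "\<And>x y. x \<in> B \<Longrightarrow> y \<in> B \<Longrightarrow> x * y \<in> Q \<Longrightarrow> x \<in> Q \<or> y \<in> Q"
    using assms by (simp_all add: prime_in_def ideal_in_def)
  show ?thesis
    unfolding prime_in_def ideal_in_def pre_def
    using A Q h_in by (auto simp: h_add h_mult h_one h_zero subring_closed)
qed

lemma ker_subset_pre: "prime_in B Q \<Longrightarrow> ker \<subseteq> pre Q"
  by (auto simp: ker_def pre_def prime_in_def ideal_in_def)

lemma pre_psubset:
  assumes "Q \<subset> Q'" "Q' \<subseteq> B"
  shows "pre Q \<subset> pre Q'"
proof -
  obtain b where "b \<in> Q'" "b \<notin> Q" using assms by blast
  moreover then obtain a where "a \<in> A" "h a = b" using h_image assms by blast
  ultimately show ?thesis using assms unfolding pre_def by blast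
qed

lemma image_mem_iff:
  assumes "prime_in A P" "ker \<subseteq> P" "a \<in> A"
  shows "h a \<in> h ` P \<longleftrightarrow> a \<in> P"
proof
  assume "h a \<in> h ` P"
  then obtain p where p: "p \<in> P" "h a = h p" by blast
  then have "p \<in> A" using assms by (auto dest: prime_ideal ideal_subset)
  then have "a - p \<in> P" using p assms A by (auto simp: ker_def h_diff subring_diff)
  then have "a - p + p \<in> P" using p assms by (intro ideal_add[OF prime_ideal])
  then show "a \<in> P" by simp
qed simp

lemma prime_image:
  assumes P: "prime_in A P" "ker \<subseteq> P"
  shows "prime_in B (h ` P)"
proof -
  have PA: "x \<in> A" if "x \<in> P" for x using that P by (auto dest: prime_ideal ideal_subset)
  note iff = image_mem_iff[OF P]
  show ?thesis
    unfolding prime_in_def ideal_in_def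
  proof (intro conjI ballI impI)
    show "h ` P \<subseteq> B" using PA h_in by blast
    show "0 \<in> h ` P" using h_zero ideal_zero[OF prime_ideal[OF P(1)]] by (metis imageI)
    show "1 \<notin> h ` P" using iff[of 1] A P by (auto simp: h_one subring_one dest: prime_proper)
  next
    fix x y assume "x \<in> h ` P" "y \<in> h ` P"
    then obtain p q where "p \<in> P" "q \<in> P" "x = h p" "y = h q" by blast
    then show "x + y \<in> h ` P"
      using PA ideal_add[OF prime_ideal[OF P(1)]] by (metis h_add imageI)
  next
    fix r x assume "r \<in> B" "x \<in> h ` P"
    then obtain a p where "a \<in> A" "r = h a" "p \<in> P" "x = h p" using h_image by blast
    then show "r * x \<in> h ` P"
      using PA ideal_mult[OF prime_ideal[OF P(1)]] by (metis h_mult imageI)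
  next
    fix x y assume "x \<in> B" "y \<in> B" and xy: "x * y \<in> h ` P"
    then obtain a b where ab: "a \<in> A" "x = h a" "b \<in> A" "y = h b" using h_image by blast
    then have "a * b \<in> P" using xy iff[of "a * b"] A by (simp add: h_mult subring_mult)
    then show "x \<in> h ` P \<or> y \<in> h ` P" using prime_prod[OF P(1)] ab by blast
  qed
qed

lemma prime_chain_pre:
  assumes "prime_chain B Qs"
  shows "prime_chain A (map pre Qs)"
proof -
  have "pre Q \<subset> pre Q'" if "Q \<in> set Qs" "Q' \<in> set Qs" "Q \<subset> Q'" for Q Q'
    using assms that by (intro pre_psubset) (auto simp: prime_chain_def prime_in_def ideal_in_def)
  then have "sorted_wrt (\<lambda>Q Q'. pre Q \<subset> pre Q') Qs"
    by (rule sorted_wrt_mono_rel) (use assms in \<open>auto simp: prime_chain_def\<close>)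
  then show ?thesis
    using assms by (simp add: prime_chain_def sorted_wrt_map prime_pre)
qed

lemma prime_chain_image:
  assumes "prime_chain A Ps" "\<And>P. P \<in> set Ps \<Longrightarrow> ker \<subseteq> P"
  shows "prime_chain B (map ((`) h) Ps)"
proof -
  have "h ` P \<subset> h ` P'" if "P \<in> set Ps" "P' \<in> set Ps" "P \<subset> P'" for P P'
  proof -
    obtain a where a: "a \<in> P'" "a \<notin> P" using \<open>P \<subset> P'\<close> by blast
    have "prime_in A P" "prime_in A P'" using assms that by (auto simp: prime_chain_def)
    then have "h a \<notin> h ` P"
      using a image_mem_iff[of P a] assms(2)[OF that(1)] by (auto dest: prime_ideal ideal_subset)
    then show ?thesis using a \<open>P \<subset> P'\<close> by blast
  qed
  then have "sorted_wrt (\<lambda>P P'. h ` P \<subset> h ` P') Ps"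
    by (rule sorted_wrt_mono_rel) (use assms(1) in \<open>auto simp: prime_chain_def\<close>)
  then show ?thesis
    using assms by (simp add: prime_chain_def sorted_wrt_map prime_image)
qed

end

lemma has_dim_iso:
  assumes "ring_surjection A B h" "inj_on h A" "has_dim A d"
  shows "has_dim B d"
proof -
  interpret ring_surjection A B h by fact
  have ker: "ker \<subseteq> P" if "prime_in A P" for P
    using that assms(2) A h_zero inj_onD[OF assms(2), of _ 0]
    by (auto simp: ker_def subring_zero prime_in_def ideal_in_def)
  obtain Ps where Ps: "prime_chain A Ps" "length Ps = Suc d" using assms(3) by (auto simp: has_dim_def)
  show ?thesis
  proof (rule has_dimI[of _ "map ((`) h) Ps"])
    show "prime_chain B (map ((`) h) Ps)"
      using Ps ker by (intro prime_chain_image) (auto simp: prime_chain_def)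
    show "length Qs \<le> Suc d" if "prime_chain B Qs" for Qs
      using has_dim_bound[OF assms(3) prime_chain_pre[OF that]] by simp
  qed (simp add: Ps)
qed

section \<open>Primes of polynomial rings over the zero ideal\<close>

lemma pseudo_division:
  fixes A :: "'a::idom set"
  assumes A: "subring_set A" and f: "f \<in> polys_over A" "f \<noteq> 0" and g: "g \<in> polys_over A"
  shows "\<exists>c\<in>A. c \<noteq> 0 \<and> (\<exists>q\<in>polys_over A. \<exists>r\<in>polys_over A.
           smult c g = q * f + r \<and> (r = 0 \<or> degree r < degree f))"
  using g
proof (induction "degree g" arbitrary: g rule: less_induct)
  case less
  note AX = subring_polys_over[OF A]
  show ?case
  proof (cases "g = 0 \<or> degree g < degree f")
    case True
    then show ?thesis using A AX less.prems
      by (intro bexI[of _ 1] conjI bexI[of _ 0] bexI[of _ g]) (auto simp: subring_closed)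
  next
    case False
    define l where "l = lead_coeff f"
    define u where "u = monom (lead_coeff g) (degree g - degree f)"
    define g1 where "g1 = smult l g - u * f"
    have lA: "l \<in> A" "l \<noteq> 0" using f by (auto simp: l_def polys_over_def)
    have uA: "u \<in> polys_over A" using less.prems A by (auto simp: u_def polys_over_def subring_zero)
    have g1A: "g1 \<in> polys_over A"
      unfolding g1_def using lA uA f less.prems A AX
      by (intro subring_diff smult_in_polys_over subring_mult) auto
    have "degree (u * f) \<le> degree g"
      using degree_mult_le[of u f] degree_monom_le[of "lead_coeff g" "degree g - degree f"] False
      unfolding u_def by linarith
    then have "degree g1 \<le> degree g"
      unfolding g1_def by (intro degree_diff_le) (auto intro: order_trans[OF degree_smult_le])
    moreover have "coeff g1 (degree g) = 0"
      using False unfolding g1_def u_def l_def by (simp add: coeff_monom_mult)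
    ultimately have "g1 = 0 \<or> degree g1 < degree g" by (rule eq_zero_or_degree_less)
    then have "\<exists>c\<in>A. c \<noteq> 0 \<and> (\<exists>q\<in>polys_over A. \<exists>r\<in>polys_over A.
        smult c g1 = q * f + r \<and> (r = 0 \<or> degree r < degree f))"
    proof
      assume "g1 = 0"
      then show ?thesis using A AX
        by (intro bexI[of _ 1] conjI bexI[of _ 0] bexI[of _ 0]) (auto simp: subring_closed)
    qed (use less.hyps g1A in blast)
    then obtain c q r where *: "c \<in> A" "c \<noteq> 0" "q \<in> polys_over A" "r \<in> polys_over A"
      "smult c g1 = q * f + r" "r = 0 \<or> degree r < degree f" by blast
    have "smult (c * l) g = (q + smult c u) * f + r"
      using *(5) unfolding g1_def by (simp add: algebra_simps smult_diff_right)
    moreover have "q + smult c u \<in> polys_over A"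
      using * uA A AX by (intro subring_add smult_in_polys_over) auto
    ultimately show ?thesis using * lA A
      by (intro bexI[of _ "c * l"] conjI) (auto simp: subring_mult)
  qed
qed

text \<open>
  The primes of \<open>A[X]\<close> over \<open>0\<close> correspond to the primes of a principal ideal domain, the polynomial ring
  over the quotient field, so a nonzero one is maximal among them. The proof avoids the quotient
  field: it compares, by pseudo-division, polynomials of least degree in \<open>P\<close> and in \<open>Q\<close> outside
  \<open>P\<close>; the multipliers are nonzero constants and can be cancelled, since they lie outside both primes.
\<close>
lemma upper_to_zero_maximal:
  fixes A :: "'a::idom set"
  assumes A: "subring_set A" and P: "prime_in (polys_over A) P" and Q: "prime_in (polys_over A) Q"
    and "P \<subset> Q" and Q0: "\<And>c. c \<in> A \<Longrightarrow> [:c:] \<in> Q \<Longrightarrow> c = 0"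
  shows "P = {0}"
proof (rule ccontr)
  assume "P \<noteq> {0}"
  note Pi = prime_ideal[OF P] and Qi = prime_ideal[OF Q] and AX = subring_polys_over[OF A]
  have const: "[:c:] \<in> polys_over A" if "c \<in> A" for c
    using that A by (simp add: pCons_in_polys_over zero_in_polys_over subring_zero)
  have cancel: "p \<in> P" if "c \<in> A" "c \<noteq> 0" "p \<in> polys_over A" "smult c p \<in> P" for c p
    using that prime_prod[OF P, of "[:c:]" p] Q0[of c] \<open>P \<subset> Q\<close> const by auto
  have "\<exists>f. f \<in> P \<and> f \<noteq> 0" using \<open>P \<noteq> {0}\<close> ideal_zero[OF Pi] by blast
  then obtain f where f: "f \<in> P" "f \<noteq> 0" "\<And>p. p \<in> P \<Longrightarrow> p \<noteq> 0 \<Longrightarrow> degree f \<le> degree p"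
    using ex_has_least_nat[of "\<lambda>f. f \<in> P \<and> f \<noteq> 0" _ degree] by blast
  have "\<exists>g. g \<in> Q \<and> g \<notin> P" using \<open>P \<subset> Q\<close> by blast
  then obtain g where g: "g \<in> Q" "g \<notin> P" "\<And>p. p \<in> Q \<Longrightarrow> p \<notin> P \<Longrightarrow> degree g \<le> degree p"
    using ex_has_least_nat[of "\<lambda>g. g \<in> Q \<and> g \<notin> P" _ degree] by blast
  have fA: "f \<in> polys_over A" and gA: "g \<in> polys_over A"
    using f g Pi Qi by (auto dest: ideal_subset)
  have "g \<noteq> 0" using g ideal_zero[OF Pi] by auto
  have gf: "degree g < degree f"
  proof (rule ccontr)
    assume "\<not> degree g < degree f"
    obtain c q r where *: "c \<in> A" "c \<noteq> 0" "q \<in> polys_over A" "r \<in> polys_over A"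
      "smult c g = q * f + r" "r = 0 \<or> degree r < degree f"
      using pseudo_division[OF A fA f(2) gA] by blast
    have qf: "q * f \<in> P" using * f Pi by (auto intro: ideal_mult)
    have "r \<notin> P"
    proof
      assume "r \<in> P"
      then have "smult c g \<in> P" using qf *(5) ideal_add[OF Pi] by simp
      then show False using cancel * gA g by blast
    qed
    moreover have "r = [:c:] * g - q * f" using *(5) by simp
    then have "r \<in> Q"
      using qf \<open>P \<subset> Q\<close> const[OF *(1)] g(1) ideal_diff[OF AX Qi] ideal_mult[OF Qi] by blast
    moreover have "r \<noteq> 0" using \<open>r \<notin> P\<close> ideal_zero[OF Pi] by auto
    ultimately show False using g(3)[of r] *(6) \<open>\<not> degree g < degree f\<close> by auto
  qed
  obtain c q r where *: "c \<in> A" "c \<noteq> 0" "q \<in> polys_over A" "r \<in> polys_over A"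
    "smult c f = q * g + r" "r = 0 \<or> degree r < degree g"
    using pseudo_division[OF A gA \<open>g \<noteq> 0\<close> fA] by blast
  have cf: "smult c f \<in> P" using ideal_mult[OF Pi const[OF *(1)] f(1)] by simp
  have "r = smult c f - q * g" using *(5) by simp
  then have "r \<in> Q" using ideal_diff[OF AX Qi] ideal_mult[OF Qi *(3) g(1)] cf \<open>P \<subset> Q\<close> by blast
  then have "r \<in> P" using g(3)[of r] *(6) ideal_zero[OF Pi] by (cases "r \<in> P") auto
  then have "r = 0" using f(3)[of r] *(6) gf by (cases "r = 0") auto
  then have qg: "smult c f = q * g" using *(5) by simp
  have "q \<in> P" using prime_prod[OF P *(3) gA] cf g(2) unfolding qg by blast
  moreover have "q \<noteq> 0" using qg *(2) f(2) by (cases "q = 0") auto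
  ultimately have "degree f \<le> degree q" using f by blast
  moreover have "degree f = degree q + degree g"
    using arg_cong[OF qg, of degree] *(2) \<open>q \<noteq> 0\<close> \<open>g \<noteq> 0\<close> by (simp add: degree_mult_eq)
  ultimately have "degree g = 0" by simp
  then obtain a where "g = [:a:]" by (rule degree_eq_zeroE)
  then show False using Q0[of a] g(1) gA \<open>g \<noteq> 0\<close> by (auto simp: pCons_in_polys_over)
qed

lemma uppers_chain_length:
  fixes A :: "'a::idom set"
  assumes A: "subring_set A" and Ps: "prime_chain (polys_over A) Ps"
    and Ps0: "\<And>P c. P \<in> set Ps \<Longrightarrow> c \<in> A \<Longrightarrow> [:c:] \<in> P \<Longrightarrow> c = 0"
  shows "length Ps \<le> 2"
proof (rule ccontr)
  assume "\<not> length Ps \<le> 2"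
  then obtain P1 P2 P3 Qs where eq: "Ps = P1 # P2 # P3 # Qs"
    by (metis One_nat_def length_Cons list.size(3) neq_Nil_conv not_less_eq_eq numeral_2_eq_2 le0)
  have "P1 = {0}" using upper_to_zero_maximal[OF A, of P1 P2] Ps Ps0 eq by (auto simp: prime_chain_def)
  moreover have "P2 = {0}" using upper_to_zero_maximal[OF A, of P2 P3] Ps Ps0 eq by (auto simp: prime_chain_def)
  ultimately show False using Ps eq by (auto simp: prime_chain_def)
qed

section \<open>Discrete valuation rings with a coefficient field\<close>

definition subfield_set :: "'a::field set \<Rightarrow> bool" where
  "subfield_set K \<longleftrightarrow> subring_set K \<and> (\<forall>x\<in>K. inverse x \<in> K)"

lemma subfield_divide: "subfield_set K \<Longrightarrow> x \<in> K \<Longrightarrow> y \<in> K \<Longrightarrow> x / y \<in> K"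
  by (simp add: subfield_set_def divide_inverse subring_mult)

lemma qfI: "a \<in> R \<Longrightarrow> b \<in> R \<Longrightarrow> b \<noteq> 0 \<Longrightarrow> a / b \<in> qf R"
  by (auto simp: qf_def)

lemma qfE:
  assumes "y \<in> qf R"
  obtains a b where "a \<in> R" "b \<in> R" "b \<noteq> 0" "y = a / b"
  using assms by (auto simp: qf_def)

lemma subset_qf: "subring_set R \<Longrightarrow> R \<subseteq> qf R"
  using qfI[of _ R 1] by (auto simp: subring_one)

lemma subfield_qf:
  assumes R: "subring_set R"
  shows "subfield_set (qf R)"
  unfolding subfield_set_def subring_set_def
proof (intro conjI ballI)
  show "1 \<in> qf R" using subset_qf[OF R] R by (auto simp: subring_one)
next
  fix x y assume "x \<in> qf R" "y \<in> qf R"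
  then obtain a b c d where *: "a \<in> R" "b \<in> R" "b \<noteq> 0" "x = a / b" "c \<in> R" "d \<in> R" "d \<noteq> 0" "y = c / d"
    by (metis qfE)
  then have "x - y = (a * d - c * b) / (b * d)" "x * y = (a * c) / (b * d)"
    by (auto simp: field_simps)
  then show "x - y \<in> qf R" "x * y \<in> qf R"
    using * R by (auto intro!: qfI simp: subring_closed)
next
  fix x assume "x \<in> qf R"
  then obtain a b where *: "a \<in> R" "b \<in> R" "b \<noteq> 0" "x = a / b" by (rule qfE)
  then show "inverse x \<in> qf R"
    using R subset_qf[OF R] by (cases "a = 0") (auto intro!: qfI simp: subring_zero)
qed

lemma qf_subset:
  assumes "subfield_set K" "R \<subseteq> K"
  shows "qf R \<subseteq> K"
proof
  fix y assume "y \<in> qf R"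
  then obtain a b where "a \<in> R" "b \<in> R" "y = a / b" by (rule qfE)
  then show "y \<in> K" using subfield_divide[OF assms(1), of a b] assms(2) by blast
qed

lemma countable_qf:
  assumes "countable R"
  shows "countable (qf R)"
proof -
  have "qf R \<subseteq> (\<lambda>(a, b). a / b) ` (R \<times> R)" by (auto simp: qf_def)
  then show ?thesis by (rule countable_subset) (simp add: assms)
qed

lemma integrally_closedD:
  "integrally_closed R \<Longrightarrow> y \<in> qf R \<Longrightarrow> p \<in> polys_over R \<Longrightarrow> lead_coeff p = 1 \<Longrightarrow> poly p y = 0 \<Longrightarrow> y \<in> R"
  by (auto simp: integrally_closed_def)

text \<open>
  A discrete valuation ring \<open>V\<close> with uniformiser \<open>x\<close> that contains a copy \<open>K\<close> of its residue field.
  The residue map takes values in that copy, so that \<open>V\<close> is the sum of \<open>K\<close> and the maximal ideal. The model is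
  the localisation of \<open>K[x]\<close> at \<open>x\<close>.
\<close>
locale coefficient_dvr =
  fixes K V :: "'a::field set" and res :: "'a \<Rightarrow> 'a" and x :: 'a
  assumes K: "subfield_set K" and V: "subring_set V" and KV: "K \<subseteq> V"
    and res_K: "c \<in> K \<Longrightarrow> res c = c" and res_in: "v \<in> V \<Longrightarrow> res v \<in> K"
    and res_diff: "v \<in> V \<Longrightarrow> w \<in> V \<Longrightarrow> res (v - w) = res v - res w"
    and res_mult: "v \<in> V \<Longrightarrow> w \<in> V \<Longrightarrow> res (v * w) = res v * res w"
    and x_in: "x \<in> V" and x_nonzero: "x \<noteq> 0" and res_x: "res x = 0"
    and unit_inverse: "v \<in> V \<Longrightarrow> res v \<noteq> 0 \<Longrightarrow> inverse v \<in> V"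
    and factor: "v \<in> V \<Longrightarrow> v \<noteq> 0 \<Longrightarrow> \<exists>e. \<exists>u\<in>V. res u \<noteq> 0 \<and> v = x ^ e * u"
begin

lemma K_ring: "subring_set K"
  using K by (simp add: subfield_set_def)

lemma res_zero: "res 0 = 0"
  using res_K[of 0] K_ring by (simp add: subring_zero)

lemma res_one: "res 1 = 1"
  using res_K[of 1] K_ring by (simp add: subring_one)

lemma res_add: "v \<in> V \<Longrightarrow> w \<in> V \<Longrightarrow> res (v + w) = res v + res w"
  using res_diff[of v "0 - w"] res_diff[of 0 w] V by (simp add: res_zero subring_closed)

lemma res_sum: "(\<And>i. i \<in> I \<Longrightarrow> f i \<in> V) \<Longrightarrow> res (sum f I) = (\<Sum>i\<in>I. res (f i))"
  by (induction I rule: infinite_finite_induct) (auto simp: res_zero res_add subring_sum V)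

lemma divide_x:
  assumes "v \<in> V" "res v = 0"
  shows "v / x \<in> V"
proof (cases "v = 0")
  case False
  then obtain e u where u: "u \<in> V" "res u \<noteq> 0" "v = x ^ e * u" using factor assms by blast
  then obtain k where "e = Suc k" using assms by (cases e) auto
  then show ?thesis using u x_nonzero V x_in by (simp add: subring_closed)
qed (simp add: V subring_zero)

lemma qf_V_cases:
  assumes "y \<in> qf V" "y \<notin> V"
  shows "inverse y \<in> V" and "res (inverse y) = 0" and "y \<noteq> 0"
proof -
  obtain a b where ab: "a \<in> V" "b \<in> V" "b \<noteq> 0" "y = a / b" using assms(1) by (rule qfE)
  have "a \<noteq> 0" using ab assms(2) V by (auto simp: subring_zero)
  then show "y \<noteq> 0" using ab by simp
  obtain d u where u: "u \<in> V" "res u \<noteq> 0" "a = x ^ d * u" using factor ab \<open>a \<noteq> 0\<close> by blast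
  obtain e w where w: "w \<in> V" "res w \<noteq> 0" "b = x ^ e * w" using factor ab by blast
  have nz: "u \<noteq> 0" "w \<noteq> 0" using u w res_zero by auto
  have "d < e"
  proof (rule ccontr)
    assume "\<not> d < e"
    then have "x ^ d = x ^ (d - e) * x ^ e" by (simp flip: power_add)
    then have "y = x ^ (d - e) * (u * inverse w)"
      using ab u w nz x_nonzero by (simp add: field_simps)
    then show False
      using assms(2) u w V unit_inverse[of w] x_in by (simp add: subring_closed)
  qed
  then have xe: "x ^ e = x * (x ^ (e - Suc d) * x ^ d)" by (simp flip: power_add power_Suc)
  have "inverse y = (x ^ e * w) / (x ^ d * u)" using ab u w by simp
  then have *: "inverse y = x * (x ^ (e - Suc d) * (w * inverse u))"
    unfolding xe using nz x_nonzero by (simp add: field_simps)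
  have **: "x ^ (e - Suc d) * (w * inverse u) \<in> V"
    using u w V unit_inverse[of u] x_in by (simp add: subring_closed)
  show "inverse y \<in> V" using * ** V x_in by (simp add: subring_closed)
  show "res (inverse y) = 0" using * ** x_in res_mult res_x by simp
qed

lemma coeff_res: "coeff (map_poly res p) i = res (coeff p i)"
  by (simp add: coeff_map_poly res_zero)

lemma res_poly:
  assumes "p \<in> polys_over V" "v \<in> V"
  shows "res (poly p v) = poly (map_poly res p) (res v)"
  using assms(1)
proof (induction p)
  case (pCons a p)
  then have "a \<in> V" "p \<in> polys_over V" by (simp_all add: pCons_in_polys_over)
  then show ?case
    using pCons assms(2) V poly_in_subring[OF V, of p v]
    by (simp add: map_poly_pCons res_zero res_add res_mult subring_mult)
qed (simp add: res_zero)

lemma map_poly_res_K: "p \<in> polys_over K \<Longrightarrow> map_poly res p = p"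
  by (rule poly_eqI) (simp add: coeff_res res_K polys_over_def)

text \<open>
  If \<open>y\<close> were not in \<open>V\<close>, then \<open>z = 1 / y\<close> would be in the maximal ideal. An integral equation for \<open>y\<close>
  multiplied by \<open>z ^ degree p\<close> writes \<open>0\<close> as \<open>1\<close> plus multiples of \<open>z\<close>, whose residue is \<open>1\<close>.
\<close>
lemma integral_in_V:
  assumes y: "y \<in> qf V" and p: "p \<in> polys_over V" "lead_coeff p = 1" "poly p y = 0"
  shows "y \<in> V"
proof (rule ccontr)
  assume "y \<notin> V"
  define z where "z = inverse y"
  have z: "z \<in> V" "res z = 0" "z * y = 1"
    using qf_V_cases[OF y \<open>y \<notin> V\<close>] by (auto simp: z_def)
  have zy: "z ^ degree p * y ^ i = z ^ (degree p - i)" if "i \<le> degree p" for i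
  proof -
    have "z ^ degree p = z ^ (degree p - i) * z ^ i" using that by (simp flip: power_add)
    moreover have "z ^ i * y ^ i = 1" using z by (simp flip: power_mult_distrib)
    ultimately show ?thesis by simp
  qed
  have "0 = z ^ degree p * poly p y" using p by simp
  also have "\<dots> = (\<Sum>i\<le>degree p. coeff p i * z ^ (degree p - i))"
    unfolding poly_altdef sum_distrib_left
    by (intro sum.cong) (simp_all add: zy[symmetric] mult_ac)
  also have "\<dots> = 1 + (\<Sum>i<degree p. coeff p i * z ^ (degree p - i))"
    using p by (simp add: lessThan_Suc_atMost[symmetric])
  finally have *: "1 + (\<Sum>i<degree p. coeff p i * z ^ (degree p - i)) = 0" by simp
  have cV: "coeff p i \<in> V" for i using p by (simp add: polys_over_def)
  have "res (coeff p i * z ^ (degree p - i)) = 0" if i: "i < degree p" for i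
  proof -
    obtain k where "degree p - i = Suc k" using i by (cases "degree p - i") auto
    then show ?thesis using z cV V by (simp add: res_mult subring_closed)
  qed
  then have "res (1 + (\<Sum>i<degree p. coeff p i * z ^ (degree p - i))) = 1"
    using cV z V by (simp add: res_add res_sum res_one subring_closed)
  then show False using * res_zero by simp
qed

text \<open>
  The constant coefficient of an equation for \<open>z\<close> is its residue, hence \<open>0\<close>; cancelling \<open>z\<close> lowers
  the degree.
\<close>
lemma maximal_ideal_transcendental:
  assumes z: "z \<in> V" "res z = 0" "z \<noteq> 0" and q: "q \<in> polys_over K" "poly q z = 0"
  shows "q = 0"
  using q
proof (induction q)
  case (pCons a q)
  then have a: "a \<in> K" "q \<in> polys_over K" by (simp_all add: pCons_in_polys_over)
  then have "poly q z \<in> V" using poly_in_subring[OF V, of q z] polys_over_mono[OF KV] z by blast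
  then have "res (a + z * poly q z) = a"
    using a z KV V by (subst res_add) (auto simp: res_mult res_K subring_mult)
  then have "a = 0" using pCons.prems res_zero by simp
  then show ?case using pCons z a by simp
qed simp

text \<open>
  The field \<open>K\<close> is algebraically closed in the quotient field of \<open>V\<close>: subtracting its residue from an
  integral element leaves an element of the maximal ideal, which is transcendental over \<open>K\<close> unless
  it is \<open>0\<close>.
\<close>
lemma algebraic_in_K:
  assumes y: "y \<in> qf V" and p: "p \<in> polys_over K" "lead_coeff p = 1" "poly p y = 0"
  shows "y \<in> K"
proof -
  have "y \<in> V" using integral_in_V[OF y _ p(2,3)] p(1) polys_over_mono[OF KV] by blast
  define c where "c = res y"
  have cK: "c \<in> K" using res_in \<open>y \<in> V\<close> by (simp add: c_def)
  define q where "q = pcompose p [:c, 1:]"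
  have "r \<in> polys_over K \<Longrightarrow> pcompose r [:c, 1:] \<in> polys_over K" for r
    using subring_polys_over[OF K_ring] cK K_ring
    by (induction r) (auto simp: pcompose_pCons pCons_in_polys_over zero_in_polys_over subring_closed
        intro!: subring_add subring_mult smult_in_polys_over)
  then have "q \<in> polys_over K" using p by (simp add: q_def)
  moreover have "poly q (y - c) = 0" using p by (simp add: q_def poly_pcompose)
  moreover have "q \<noteq> 0" using p(2) by (auto simp: q_def pcompose_eq_0_iff)
  moreover have "y - c \<in> V" "res (y - c) = 0"
    using \<open>y \<in> V\<close> cK KV V by (auto simp: res_diff res_K subring_diff c_def)
  ultimately have "y - c = 0" using maximal_ideal_transcendental by blast
  then show ?thesis using cK by simp
qed

end

lemma countable_polys_over:
  assumes "countable (E :: 'a::zero set)"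
  shows "countable (polys_over E)"
proof -
  have "polys_over E \<subseteq> Poly ` lists E"
  proof
    fix p assume "p \<in> polys_over E"
    then have "coeffs p \<in> lists E" by (auto simp: polys_over_def coeffs_def split: if_splits)
    then show "p \<in> Poly ` lists E" by (metis Poly_coeffs imageI)
  qed
  then show ?thesis by (rule countable_subset) (simp add: assms)
qed

text \<open>
  Only countably many complex numbers are roots of nonzero polynomials over a countable set.
\<close>
lemma exists_transcendental:
  fixes K :: "complex set"
  assumes "countable K"
  shows "\<exists>x. \<forall>p\<in>polys_over K. poly p x = 0 \<longrightarrow> p = 0"
proof (rule ccontr)
  assume "\<nexists>x. \<forall>p\<in>polys_over K. poly p x = 0 \<longrightarrow> p = 0"
  then have "(UNIV :: complex set) = (\<Union>p\<in>polys_over K - {0}. {x. poly p x = 0})" by blast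
  moreover have "countable (\<Union>p\<in>polys_over K - {0}. {x. poly p x = 0})"
    using countable_polys_over[OF assms]
    by (intro countable_UN) (auto intro: countable_finite poly_roots_finite)
  ultimately have "countable (UNIV :: complex set)" by simp
  then have "countable (range complex_of_real)" by (rule countable_subset[rotated]) simp
  then show False
    using uncountable_UNIV_real countable_image_inj_on[of complex_of_real UNIV] by (simp add: inj_on_def)
qed

lemma exists_coefficient_dvr:
  fixes K :: "complex set"
  assumes K: "subfield_set K" and "countable K"
  shows "\<exists>V res x. coefficient_dvr K V res x \<and> countable V"
proof -
  obtain x where x: "\<And>p. p \<in> polys_over K \<Longrightarrow> poly p x = 0 \<Longrightarrow> p = 0"
    using exists_transcendental[OF \<open>countable K\<close>] by blast
  have Kr: "subring_set K" using K by (simp add: subfield_set_def)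
  note KX = subring_polys_over[OF Kr]
  \<comment> \<open>The localisation of K[x] at x. Transcendence of x makes the residue, the quotient of the
    constant coefficients, independent of the chosen fraction.\<close>
  define Den where "Den = {g \<in> polys_over K. coeff g 0 \<noteq> 0}"
  define V where "V = {poly f x / poly g x | f g. f \<in> polys_over K \<and> g \<in> Den}"
  define res where "res v = (SOME r. \<exists>f\<in>polys_over K. \<exists>g\<in>Den.
     v = poly f x / poly g x \<and> r = coeff f 0 / coeff g 0)" for v
  have Den: "g \<in> polys_over K" "poly g x \<noteq> 0" "coeff g 0 \<noteq> 0" "g \<noteq> 0" if "g \<in> Den" for g
    using that x[of g] by (auto simp: Den_def)
  have Den_mult: "g * g' \<in> Den" if "g \<in> Den" "g' \<in> Den" for g g'
    using that KX by (auto simp: Den_def subring_mult coeff_mult)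
  have one: "1 \<in> Den" using KX by (simp add: Den_def subring_one)
  have VI: "poly f x / poly g x \<in> V" if "f \<in> polys_over K" "g \<in> Den" for f g
    using that by (auto simp: V_def)
  have VE: "\<exists>f\<in>polys_over K. \<exists>g\<in>Den. v = poly f x / poly g x" if "v \<in> V" for v
    using that by (auto simp: V_def)
  have res: "res (poly f x / poly g x) = coeff f 0 / coeff g 0" if fg: "f \<in> polys_over K" "g \<in> Den" for f g
    unfolding res_def
  proof (rule some_equality)
    show "\<exists>f'\<in>polys_over K. \<exists>g'\<in>Den. poly f x / poly g x = poly f' x / poly g' x \<and>
        coeff f 0 / coeff g 0 = coeff f' 0 / coeff g' 0" using fg by blast
  next
    fix r assume "\<exists>f'\<in>polys_over K. \<exists>g'\<in>Den. poly f x / poly g x = poly f' x / poly g' x \<and>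
        r = coeff f' 0 / coeff g' 0"
    then obtain f' g' where *: "f' \<in> polys_over K" "g' \<in> Den"
      "poly f x / poly g x = poly f' x / poly g' x" "r = coeff f' 0 / coeff g' 0" by blast
    have "poly (f * g' - f' * g) x = 0" using * Den fg by (simp add: field_simps)
    moreover have "f * g' - f' * g \<in> polys_over K"
      using * fg Den KX by (intro subring_diff subring_mult) auto
    ultimately have "f * g' = f' * g" using x by fastforce
    then have "coeff f 0 * coeff g' 0 = coeff f' 0 * coeff g 0" by (metis coeff_mult_0)
    then show "r = coeff f 0 / coeff g 0"
      unfolding *(4) using Den(3)[OF *(2)] Den(3)[OF fg(2)] by (simp add: frac_eq_eq)
  qed
  have const: "[:c:] \<in> polys_over K" if "c \<in> K" for c
    using that Kr by (simp add: pCons_in_polys_over zero_in_polys_over subring_zero)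
  have X: "[:0, 1:] \<in> polys_over K"
    using Kr by (simp add: pCons_in_polys_over zero_in_polys_over subring_closed)
  have cV: "c \<in> V" "res c = c" if "c \<in> K" for c
    using VI[OF const[OF that] one] res[OF const[OF that] one] by simp_all
  have "coefficient_dvr K V res x"
  proof
    show "subfield_set K" "K \<subseteq> V" using K cV by auto
    show "\<And>c. c \<in> K \<Longrightarrow> res c = c" by (rule cV)
    have closed: "v - w \<in> V" "v * w \<in> V" "res (v - w) = res v - res w" "res (v * w) = res v * res w"
      if vw: "v \<in> V" "w \<in> V" for v w
    proof -
      obtain f g f' g' where *: "f \<in> polys_over K" "g \<in> Den" "v = poly f x / poly g x"
        "f' \<in> polys_over K" "g' \<in> Den" "w = poly f' x / poly g' x"
        using VE[OF vw(1)] VE[OF vw(2)] by blast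
      have m: "f * g' - f' * g \<in> polys_over K" "f * f' \<in> polys_over K" "g * g' \<in> Den"
        using * Den Den_mult KX by (auto intro!: subring_diff subring_mult)
      have d: "v - w = poly (f * g' - f' * g) x / poly (g * g') x"
        "v * w = poly (f * f') x / poly (g * g') x"
        unfolding *(3,6) using Den(2)[OF *(2)] Den(2)[OF *(5)] by (simp_all add: field_simps)
      show "v - w \<in> V" "v * w \<in> V" unfolding d by (rule VI[OF m(1,3)], rule VI[OF m(2,3)])
      show "res (v - w) = res v - res w" "res (v * w) = res v * res w"
        unfolding res[OF m(1,3), folded d(1)] res[OF m(2,3), folded d(2)]
          res[OF *(1,2), folded *(3)] res[OF *(4,5), folded *(6)]
        using Den(3)[OF *(2)] Den(3)[OF *(5)] by (simp_all add: coeff_mult_0 field_simps)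
    qed
    show "subring_set V" using closed cV Kr by (auto simp: subring_set_def)
    show "\<And>v w. v \<in> V \<Longrightarrow> w \<in> V \<Longrightarrow> res (v - w) = res v - res w"
      "\<And>v w. v \<in> V \<Longrightarrow> w \<in> V \<Longrightarrow> res (v * w) = res v * res w"
      using closed by auto
    show "x \<in> V" "res x = 0" using VI[OF X one] res[OF X one] by simp_all
    show "x \<noteq> 0" using x[of "[:0, 1:]"] X by auto
  next
    fix v assume "v \<in> V"
    then obtain f g where fg: "f \<in> polys_over K" "g \<in> Den" "v = poly f x / poly g x"
      using VE by blast
    show "res v \<in> K"
      using fg Den[of g] res[of f g] subfield_divide[OF K] by (auto simp: polys_over_def)
    show "inverse v \<in> V" if "res v \<noteq> 0"
    proof -
      have "f \<in> Den" using fg that res[of f g] by (auto simp: Den_def)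
      then show ?thesis using VI[of g f] fg Den by simp
    qed
    assume "v \<noteq> 0"
    have "\<exists>e. \<exists>h\<in>Den. poly f x = x ^ e * poly h x" if "f \<in> polys_over K" "f \<noteq> 0" for f
      using that
    proof (induction f)
      case (pCons a f)
      then have af: "a \<in> K" "f \<in> polys_over K" by (simp_all add: pCons_in_polys_over)
      show ?case
      proof (cases "a = 0")
        case True
        then obtain e h where "h \<in> Den" "poly f x = x ^ e * poly h x" using pCons af by auto
        then show ?thesis using True by (intro exI[of _ "Suc e"] bexI[of _ h]) simp_all
      next
        case False
        then have "pCons a f \<in> Den" using pCons by (simp add: Den_def)
        then show ?thesis by (intro exI[of _ 0] bexI[of _ "pCons a f"]) simp_all
      qed
    qed simp
    then obtain e h where h: "h \<in> Den" "poly f x = x ^ e * poly h x" using fg \<open>v \<noteq> 0\<close> by fastforce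
    then show "\<exists>e. \<exists>u\<in>V. res u \<noteq> 0 \<and> v = x ^ e * u"
      using fg Den[of h] Den[of g] res[of h g] VI[of h g]
      by (intro exI[of _ e] bexI[of _ "poly h x / poly g x"]) auto
  qed
  moreover have "V \<subseteq> (\<lambda>(f, g). poly f x / poly g x) ` (polys_over K \<times> polys_over K)"
    using Den by (auto simp: V_def)
  then have "countable V"
    by (rule countable_subset) (simp add: countable_polys_over \<open>countable K\<close>)
  ultimately show ?thesis by blast
qed

section \<open>Pullbacks along the residue map\<close>

text \<open>
  The zero ideal is excluded so that fields satisfy the condition. For every other
  ideal \<open>J\<close> it rules out \<open>J\<^sup>v = R\<close>, and those \<open>J\<close> are all that the operation \<open>w\<close> depends on.
\<close>
definition nontrivial_inverses :: "'a::field set \<Rightarrow> bool" where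
  "nontrivial_inverses R \<longleftrightarrow>
     (\<forall>J. ideal_in R J \<and> J \<noteq> {0} \<and> 1 \<notin> J \<longrightarrow> (\<exists>y\<in>qf R - R. \<forall>a\<in>J. y * a \<in> R))"

lemma common_denominator:
  assumes R: "subring_set R" and p: "p \<in> polys_over (qf R)"
  shows "\<exists>r\<in>R. r \<noteq> 0 \<and> smult r p \<in> polys_over R"
  using p
proof (induction p)
  case 0
  then show ?case using R by (intro bexI[of _ 1]) (auto simp: zero_in_polys_over subring_closed)
next
  case (pCons a p)
  then obtain r where r: "r \<in> R" "r \<noteq> 0" "smult r p \<in> polys_over R"
    by (auto simp: pCons_in_polys_over)
  obtain b c where bc: "b \<in> R" "c \<in> R" "c \<noteq> 0" "a = b / c"
    using pCons.prems by (auto simp: pCons_in_polys_over elim: qfE)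
  have "r * c * a = r * b" using bc by simp
  moreover have "smult c (smult r p) \<in> polys_over R"
    using smult_in_polys_over[OF R bc(2) r(3)] .
  ultimately have "smult (r * c) (pCons a p) \<in> polys_over R"
    using R r bc by (simp add: pCons_in_polys_over subring_mult mult.commute)
  then show ?case using r bc R by (intro bexI[of _ "r * c"]) (auto simp: subring_mult)
qed

text \<open>
  The pullback of \<open>R\<close> along the residue map \<open>V \<rightarrow> K\<close>, a variant of the \<open>D + M\<close> construction in which
  the quotient field of \<open>R\<close> may be smaller than \<open>K\<close>.
\<close>
locale pullback = coefficient_dvr K V res x
  for K V :: "'a::field set" and res x +
  fixes R :: "'a set"
  assumes R: "subring_set R" and RK: "R \<subseteq> K"
begin

definition T :: "'a set" where "T = {v \<in> V. res v \<in> R}"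

definition M :: "'a set" where "M = {v \<in> V. res v = 0}"

lemma T_subset_V: "T \<subseteq> V"
  by (auto simp: T_def)

lemma M_subset_T: "M \<subseteq> T"
  by (auto simp: T_def M_def R subring_zero)

lemma R_subset_T: "R \<subseteq> T"
  using RK KV by (auto simp: T_def res_K subset_iff)

lemma x_in_M: "x \<in> M"
  by (simp add: M_def x_in res_x)

lemma M_mult: "m \<in> M \<Longrightarrow> v \<in> V \<Longrightarrow> v * m \<in> M"
  by (simp add: M_def res_mult subring_mult V)

lemma M_divide_x: "m \<in> M \<Longrightarrow> m / x \<in> V"
  by (simp add: M_def divide_x)

lemma T_ring: "subring_set T"
  unfolding subring_set_def T_def
  using V R by (auto simp: res_diff res_mult res_one subring_closed)

lemma qf_T: "qf T = qf V"
proof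
  show "qf T \<subseteq> qf V" using T_subset_V by (auto simp: qf_def)
  show "qf V \<subseteq> qf T"
  proof (rule qf_subset)
    show "subfield_set (qf T)" by (rule subfield_qf[OF T_ring])
    show "V \<subseteq> qf T"
    proof
      fix v assume "v \<in> V"
      then have "v * x \<in> T" "x \<in> T" using M_mult[OF x_in_M] x_in_M M_subset_T by blast+
      then have "v * x / x \<in> qf T" using x_nonzero by (intro qfI)
      then show "v \<in> qf T" using x_nonzero by simp
    qed
  qed
qed

sublocale residue: ring_surjection T R res
proof
  show "res ` T = R"
  proof
    show "R \<subseteq> res ` T"
    proof
      fix r assume "r \<in> R"
      then have "res r = r" using RK by (auto intro: res_K)
      then show "r \<in> res ` T" using \<open>r \<in> R\<close> R_subset_T by (metis imageI subsetD)
    qed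
  qed (auto simp: T_def)
qed (use T_ring R in \<open>auto simp: T_def res_diff res_mult res_one\<close>)

lemma residue_ker: "residue.ker = M"
  unfolding residue.ker_def by (auto simp: T_def M_def R subring_zero)

text \<open>
  A nonzero \<open>p\<close> in \<open>P\<close> divides a high power of every element of \<open>M\<close> already in \<open>T\<close>, because the
  cofactor, still divisible by \<open>x\<close>, lies in \<open>M\<close>. So \<open>M\<close> is the least nonzero prime.
\<close>
lemma prime_not_above_M:
  assumes P: "prime_in T P" and "\<not> M \<subseteq> P"
  shows "P = {0}"
proof (rule ccontr)
  assume "P \<noteq> {0}"
  then obtain p where p: "p \<in> P" "p \<noteq> 0" using ideal_zero[OF prime_ideal[OF P]] by blast
  then have "p \<in> V" using ideal_mem[OF prime_ideal[OF P]] T_subset_V by blast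
  then obtain e u where u: "u \<in> V" "res u \<noteq> 0" "p = x ^ e * u" using factor p by blast
  have "u \<noteq> 0" using u res_zero by auto
  have "m \<in> P" if m: "m \<in> M" for m
  proof -
    define v where "v = m / x"
    have v: "v \<in> V" "m = x * v" using M_divide_x[OF m] x_nonzero by (simp_all add: v_def)
    have "v ^ Suc e * inverse u * x \<in> M"
      using v u V unit_inverse by (intro M_mult x_in_M subring_mult subring_power) auto
    then have "v ^ Suc e * inverse u * x * p \<in> P"
      using M_subset_T ideal_mult[OF prime_ideal[OF P] _ p(1)] by blast
    also have "v ^ Suc e * inverse u * x * p = m ^ Suc e"
      unfolding v(2) u(3) power_mult_distrib using \<open>u \<noteq> 0\<close> by (simp add: field_simps)
    finally show ?thesis using prime_power[OF T_ring P] m M_subset_T by blast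
  qed
  then show False using \<open>\<not> M \<subseteq> P\<close> by blast
qed

lemma has_dim_pullback:
  assumes "has_dim R n"
  shows "has_dim T (Suc n)"
proof -
  obtain Qs where Qs: "prime_chain R Qs" "length Qs = Suc n" using assms by (auto simp: has_dim_def)
  have "P \<noteq> {0}" if "P \<in> set (map residue.pre Qs)" for P
  proof -
    have "x \<in> P"
      using that Qs(1) residue.ker_subset_pre x_in_M unfolding residue_ker
      by (auto simp: prime_chain_def)
    then show ?thesis using x_nonzero by auto
  qed
  then have "prime_chain T ({0} # map residue.pre Qs)"
    by (intro prime_chain_zero_Cons T_ring residue.prime_chain_pre Qs)
  then show ?thesis
  proof (rule has_dimI)
    fix Ps assume "prime_chain T Ps"
    then obtain Ls Hs where LH: "Ps = Ls @ Hs" "prime_chain T Ls" "prime_chain T Hs"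
      "\<And>P. P \<in> set Ls \<Longrightarrow> \<not> M \<subseteq> P" "\<And>P. P \<in> set Hs \<Longrightarrow> M \<subseteq> P"
      by (rule chain_split[where I = M]) blast
    have "length Ls \<le> 1"
      using LH(2,4) prime_not_above_M by (intro sorted_psubset_const[of _ "{0}"]) (auto simp: prime_chain_def)
    moreover have "length Hs \<le> Suc n"
      using has_dim_bound[OF assms residue.prime_chain_image[OF LH(3)]] LH(5)
      by (simp add: residue_ker)
    ultimately show "length Ps \<le> Suc (Suc n)" using LH(1) by simp
  qed (simp add: Qs)
qed

text \<open>
  An ideal inside \<open>M\<close> is mapped into \<open>T\<close> by all elements of \<open>V\<close>, and even by \<open>1 / x\<close> if \<open>T\<close> is
  \<open>V\<close> itself. An ideal not inside \<open>M\<close> contains a unit of \<open>V\<close>, hence all of \<open>M\<close>; it is therefore the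
  preimage of an ideal of \<open>R\<close>, and an element of the inverse of that ideal does the job.
\<close>
lemma nontrivial_inverses_pullback:
  assumes "nontrivial_inverses R"
  shows "nontrivial_inverses T"
  unfolding nontrivial_inverses_def
proof (intro allI impI)
  fix J assume J: "ideal_in T J \<and> J \<noteq> {0} \<and> 1 \<notin> J"
  then have Ji: "ideal_in T J" by simp
  show "\<exists>y\<in>qf T - T. \<forall>a\<in>J. y * a \<in> T"
  proof (cases "J \<subseteq> M")
    case True
    show ?thesis
    proof (cases "V \<subseteq> T")
      case True
      have "inverse x \<notin> V"
        using res_mult[of x "inverse x"] x_in x_nonzero res_x res_one by auto
      then have "inverse x \<in> qf T - T"
        using qfI[of 1 T x] T_ring x_in_M M_subset_T x_nonzero T_subset_V
        by (auto simp: subring_one divide_inverse subset_iff)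
      moreover have "inverse x * a \<in> T" if "a \<in> J" for a
        using that \<open>J \<subseteq> M\<close> M_divide_x[of a] True by (auto simp: divide_inverse mult.commute)
      ultimately show ?thesis by blast
    next
      case False
      then obtain y where y: "y \<in> V" "y \<notin> T" by blast
      then have "y \<in> qf T" using subset_qf[OF V] qf_T by blast
      moreover have "y * a \<in> T" if "a \<in> J" for a
        using that \<open>J \<subseteq> M\<close> M_mult[of a y] y M_subset_T by blast
      ultimately show ?thesis using y by blast
    qed
  next
    case False
    then obtain j where j: "j \<in> J" "j \<notin> M" by blast
    then have jV: "j \<in> V" "res j \<noteq> 0" using ideal_mem[OF Ji] T_subset_V by (auto simp: M_def)
    have MJ: "m \<in> J" if "m \<in> M" for m
    proof -
      have "m * inverse j \<in> T"
        using M_mult[OF that unit_inverse[OF jV]] M_subset_T by (auto simp: mult.commute)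
      then have "m * inverse j * j \<in> J" using ideal_mult[OF Ji _ j(1)] by blast
      moreover have "j \<noteq> 0" using jV res_zero by auto
      then have "m * inverse j * j = m" by simp
      ultimately show ?thesis by metis
    qed
    define J0 where "J0 = J \<inter> R"
    have res_J: "res a \<in> J0" if "a \<in> J" for a
    proof -
      have a: "a \<in> V" "res a \<in> R" using ideal_mem[OF Ji that] by (auto simp: T_def)
      then have "res a \<in> V" "res (res a) = res a" using RK KV by (auto intro: res_K)
      then have "a - res a \<in> M" using a V by (simp add: M_def res_diff subring_diff)
      then have "a - (a - res a) \<in> J" using ideal_diff[OF T_ring Ji that] MJ by blast
      then show ?thesis using a by (simp add: J0_def)
    qed
    have "ideal_in R J0"
      using Ji R R_subset_T unfolding J0_def ideal_in_def by (auto simp: subring_closed)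
    moreover have "J0 \<noteq> {0}" using res_J[OF j(1)] jV by auto
    moreover have "1 \<notin> J0" using J by (simp add: J0_def)
    ultimately obtain y where y: "y \<in> qf R" "y \<notin> R" "\<And>a. a \<in> J0 \<Longrightarrow> y * a \<in> R"
      using assms unfolding nontrivial_inverses_def by blast
    have yK: "y \<in> K" using qf_subset[OF K RK] y by blast
    then have yV: "y \<in> V" "res y = y" using KV by (auto intro: res_K)
    have "y \<in> qf T - T"
      using yV y subset_qf[OF V] qf_T by (auto simp: T_def)
    moreover have "y * a \<in> T" if "a \<in> J" for a
      using y(3)[OF res_J[OF that]] ideal_mem[OF Ji that] yV V
      by (auto simp: T_def res_mult subring_mult)
    ultimately show ?thesis by blast
  qed
qed

text \<open>
  An integral element lies in the integrally closed ring \<open>V\<close>, and its residue is integral over \<open>R\<close>.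
\<close>
lemma integrally_closed_pullback:
  assumes "\<And>c p. c \<in> K \<Longrightarrow> p \<in> polys_over R \<Longrightarrow> lead_coeff p = 1 \<Longrightarrow> poly p c = 0 \<Longrightarrow> c \<in> R"
  shows "integrally_closed T"
  unfolding integrally_closed_def
proof (intro ballI impI)
  fix y assume "y \<in> qf T" "\<exists>p\<in>polys_over T. lead_coeff p = 1 \<and> poly p y = 0"
  then obtain p where p: "p \<in> polys_over T" "lead_coeff p = 1" "poly p y = 0" by blast
  have pV: "p \<in> polys_over V" using p polys_over_mono[OF T_subset_V] by blast
  have yV: "y \<in> V" using \<open>y \<in> qf T\<close> integral_in_V[OF _ pV p(2,3)] by (simp add: qf_T)
  have "map_poly res p \<in> polys_over R" using p by (auto simp: polys_over_def coeff_res T_def)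
  moreover have "coeff (map_poly res p) (degree p) = 1" using p(2) by (simp add: coeff_res res_one)
  then have "degree (map_poly res p) = degree p"
    by (intro antisym map_poly_degree_leq le_degree) simp
  then have "lead_coeff (map_poly res p) = 1" using p(2) by (simp add: coeff_res res_one)
  moreover have "poly (map_poly res p) (res y) = 0" using res_poly[OF pV yV] p(3) res_zero by simp
  ultimately have "res y \<in> R" using assms res_in[OF yV] by blast
  then show "y \<in> T" using yV by (simp add: T_def)
qed

sublocale poly_residue: ring_surjection "polys_over T" "polys_over R" "map_poly res"
proof
  show "subring_set (polys_over T)" "subring_set (polys_over R)"
    using T_ring R by (auto intro: subring_polys_over)
  fix p q assume pq: "p \<in> polys_over T" "q \<in> polys_over T"
  then have V': "coeff p i \<in> V" "coeff q i \<in> V" for i by (auto simp: polys_over_def T_def)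
  show "map_poly res (p - q) = map_poly res p - map_poly res q"
    by (rule poly_eqI) (simp add: coeff_res res_diff V')
  show "map_poly res (p * q) = map_poly res p * map_poly res q"
    by (rule poly_eqI) (simp add: coeff_res coeff_mult res_sum res_mult V' V subring_mult)
next
  show "map_poly res 1 = 1" by (simp add: res_one)
  show "map_poly res ` polys_over T = polys_over R"
  proof
    show "map_poly res ` polys_over T \<subseteq> polys_over R"
      by (auto simp: polys_over_def coeff_res T_def)
    show "polys_over R \<subseteq> map_poly res ` polys_over T"
    proof
      fix p assume "p \<in> polys_over R"
      then have "p = map_poly res p" "p \<in> polys_over T"
        using map_poly_res_K polys_over_mono[OF RK] polys_over_mono[OF R_subset_T] by auto
      then show "p \<in> map_poly res ` polys_over T" by (rule image_eqI)
    qed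
  qed
qed

lemma poly_residue_ker: "poly_residue.ker = polys_over M"
  unfolding poly_residue.ker_def
  by (auto simp: polys_over_def poly_eq_iff coeff_res M_def T_def R subring_zero)

lemma const_in: "c \<in> T \<Longrightarrow> [:c:] \<in> polys_over T"
  using T_ring by (simp add: pCons_in_polys_over zero_in_polys_over subring_zero)

lemma prime_contraction:
  assumes Q: "prime_in (polys_over T) Q"
  shows "prime_in T {c \<in> T. [:c:] \<in> Q}"
proof -
  note Qi = prime_ideal[OF Q]
  have "[:c + d:] \<in> Q" if "[:c:] \<in> Q" "[:d:] \<in> Q" for c d
    using ideal_add[OF Qi that] by simp
  moreover have "[:c * d:] \<in> Q" if "c \<in> T" "[:d:] \<in> Q" for c d
    using ideal_mult[OF Qi const_in[OF that(1)] that(2)] by (simp add: mult.commute)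
  moreover have "[:c:] \<in> Q \<or> [:d:] \<in> Q" if "[:c * d:] \<in> Q" "c \<in> T" "d \<in> T" for c d
    using prime_prod[OF Q const_in[OF that(2)] const_in[OF that(3)]] that by (simp add: mult.commute)
  moreover have "[:1:] \<notin> Q" using prime_proper[OF Q] by (simp flip: one_pCons)
  moreover have "[:0:] \<in> Q" using ideal_zero[OF Qi] by simp
  ultimately show ?thesis
    using T_ring by (auto simp: prime_in_def ideal_in_def subring_closed)
qed

lemma upper_to_zero_not_above_M:
  assumes Q: "prime_in (polys_over T) Q" "\<not> polys_over M \<subseteq> Q" and c: "c \<in> T" "[:c:] \<in> Q"
  shows "c = 0"
proof -
  note Qi = prime_ideal[OF Q(1)]
  have "\<not> M \<subseteq> {c \<in> T. [:c:] \<in> Q}"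
  proof
    assume M: "M \<subseteq> {c \<in> T. [:c:] \<in> Q}"
    have "p \<in> Q" if "p \<in> polys_over M" for p
      using that
    proof (induction p)
      case (pCons a p)
      then have "[:a:] \<in> Q" "p \<in> Q" using M by (auto simp: pCons_in_polys_over)
      moreover have "[:0, 1:] \<in> polys_over T"
        using T_ring by (simp add: pCons_in_polys_over zero_in_polys_over subring_closed)
      ultimately have "[:a:] + [:0, 1:] * p \<in> Q" using ideal_add[OF Qi] ideal_mult[OF Qi] by blast
      then show ?case by simp
    qed (simp add: ideal_zero[OF Qi])
    then show False using Q(2) by blast
  qed
  then have "{c \<in> T. [:c:] \<in> Q} = {0}" by (rule prime_not_above_M[OF prime_contraction[OF Q(1)]])
  then show ?thesis using c by blast
qed

text \<open>
  The upper part of a chain lives in the quotient \<open>R[X]\<close>; the lower part consists of primes over \<open>0\<close>,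
  of which there are at most two.
\<close>
lemma poly_chain_split:
  assumes "prime_chain (polys_over T) Ps"
  obtains Ls Hs where "Ps = Ls @ Hs" "prime_chain (polys_over T) Ls" "length Ls \<le> 2"
    "\<And>P. P \<in> set Ls \<Longrightarrow> \<not> polys_over M \<subseteq> P"
    "\<And>P Q. P \<in> set Ls \<Longrightarrow> Q \<in> set Hs \<Longrightarrow> P \<subset> Q"
    "prime_chain (polys_over R) (map ((`) (map_poly res)) Hs)"
proof -
  obtain Ls Hs where LH: "Ps = Ls @ Hs" "prime_chain (polys_over T) Ls" "prime_chain (polys_over T) Hs"
    "\<And>P. P \<in> set Ls \<Longrightarrow> \<not> polys_over M \<subseteq> P" "\<And>P. P \<in> set Hs \<Longrightarrow> polys_over M \<subseteq> P"
    "\<And>P Q. P \<in> set Ls \<Longrightarrow> Q \<in> set Hs \<Longrightarrow> P \<subset> Q"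
    by (rule chain_split[OF assms, where I = "polys_over M"]) blast
  have "length Ls \<le> 2"
    using LH(2,4) upper_to_zero_not_above_M
    by (intro uppers_chain_length[OF T_ring LH(2)]) (auto simp: prime_chain_def)
  moreover have "prime_chain (polys_over R) (map ((`) (map_poly res)) Hs)"
    using LH by (intro poly_residue.prime_chain_image) (auto simp: poly_residue_ker)
  ultimately show ?thesis using that[OF LH(1,2) _ LH(4,6)] by blast
qed

lemma poly_chain_pre:
  assumes Qs: "prime_chain (polys_over R) Qs"
  shows "prime_chain (polys_over T) ({0} # map poly_residue.pre Qs)"
    and "\<And>P. P \<in> set (map poly_residue.pre Qs) \<Longrightarrow> polys_over M \<subseteq> P"
proof -
  show above: "polys_over M \<subseteq> P" if "P \<in> set (map poly_residue.pre Qs)" for P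
    using that Qs poly_residue.ker_subset_pre unfolding poly_residue_ker
    by (auto simp: prime_chain_def)
  have "[:x:] \<in> polys_over M"
    using x_in_M V by (simp add: pCons_in_polys_over zero_in_polys_over M_def res_zero subring_zero)
  then have "P \<noteq> {0}" if "P \<in> set (map poly_residue.pre Qs)" for P
    using above[OF that] x_nonzero by auto
  then show "prime_chain (polys_over T) ({0} # map poly_residue.pre Qs)"
    using subring_polys_over[OF T_ring]
    by (intro prime_chain_zero_Cons poly_residue.prime_chain_pre Qs)
qed

lemma poly_primitive_part:
  assumes "f \<in> polys_over V" "f \<noteq> 0"
  shows "\<exists>e. \<exists>g\<in>polys_over V. f = smult (x ^ e) g \<and> g \<notin> polys_over M"
proof -
  have "\<exists>e. \<exists>g\<in>polys_over V. f = smult (x ^ e) g \<and> g \<notin> polys_over M"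
    if "f \<in> polys_over V" "coeff f i = x ^ k * u" "u \<in> V" "res u \<noteq> 0" for f i k u
    using that
  proof (induction k arbitrary: f)
    case 0
    then have "coeff f i \<notin> M" by (simp add: M_def)
    then have "f \<notin> polys_over M" by (auto simp: polys_over_def)
    then show ?case using 0 by (intro exI[of _ 0] bexI[of _ f]) simp_all
  next
    case (Suc k)
    show ?case
    proof (cases "f \<in> polys_over M")
      case False
      then show ?thesis using Suc by (intro exI[of _ 0] bexI[of _ f]) simp_all
    next
      case True
      define f' where "f' = smult (inverse x) f"
      have f: "f = smult x f'" using x_nonzero by (simp add: f'_def)
      have "inverse x * m \<in> V" if "m \<in> M" for m
        using M_divide_x[OF that] by (simp add: divide_inverse mult.commute)
      then have "f' \<in> polys_over V" using True by (auto simp: f'_def polys_over_def)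
      moreover have "coeff f' i = x ^ k * u" using Suc.prems x_nonzero by (simp add: f'_def)
      ultimately obtain e g where "g \<in> polys_over V" "f' = smult (x ^ e) g" "g \<notin> polys_over M"
        using Suc.IH[of f'] Suc.prems by blast
      then show ?thesis unfolding f by (intro exI[of _ "Suc e"] bexI[of _ g]) simp_all
    qed
  qed
  moreover obtain i where "coeff f i \<noteq> 0" using assms by (auto simp: poly_eq_iff)
  moreover have "coeff f i \<in> V" using assms by (simp add: polys_over_def)
  then obtain e u where "u \<in> V" "res u \<noteq> 0" "coeff f i = x ^ e * u"
    using factor \<open>coeff f i \<noteq> 0\<close> by blast
  ultimately show ?thesis using assms by blast
qed

text \<open>
  Dividing a nonzero polynomial in \<open>Q\<close> by the largest possible power of \<open>x\<close> leaves a polynomial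
  with nonzero residue. As its residue has coefficients in the quotient field of \<open>R\<close>, a constant from \<open>R\<close>
  brings it into \<open>T[X]\<close>, and then into \<open>Q\<close>, since \<open>Q\<close> contains no nonzero constant.
\<close>
lemma upper_to_zero_not_below_M:
  assumes KR: "K = qf R" and Q: "prime_in (polys_over T) Q" "Q \<noteq> {0}"
    and Q0: "\<And>c. c \<in> T \<Longrightarrow> [:c:] \<in> Q \<Longrightarrow> c = 0"
  shows "\<not> Q \<subseteq> polys_over M"
proof -
  note Qi = prime_ideal[OF Q(1)]
  obtain f where f: "f \<in> Q" "f \<noteq> 0" using Q ideal_zero[OF Qi] by blast
  have "f \<in> polys_over V" using ideal_mem[OF Qi f(1)] polys_over_mono[OF T_subset_V] by blast
  then obtain e g where g: "g \<in> polys_over V" "f = smult (x ^ e) g" "g \<notin> polys_over M"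
    using poly_primitive_part f by blast
  have "map_poly res g \<in> polys_over (qf R)"
    using g res_in KR by (auto simp: polys_over_def coeff_res)
  then obtain r where r: "r \<in> R" "r \<noteq> 0" "smult r (map_poly res g) \<in> polys_over R"
    using common_denominator[OF R] by blast
  have rT: "r \<in> T" "r \<in> V" "res r = r" using r R_subset_T RK KV by (auto intro: res_K)
  have gV: "coeff g i \<in> V" for i using g by (simp add: polys_over_def)
  have rg: "smult r g \<in> polys_over T"
    using r rT gV V by (auto simp: polys_over_def T_def coeff_res res_mult subring_mult)
  have xT: "x ^ e \<in> T" using subring_power[OF T_ring] x_in_M M_subset_T by blast
  have "[:r:] * f \<in> Q" using ideal_mult[OF Qi const_in[OF rT(1)] f(1)] .
  also have "[:r:] * f = [:x ^ e:] * smult r g" by (simp add: g(2) mult.commute)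
  finally have "[:x ^ e:] \<in> Q \<or> smult r g \<in> Q" using prime_prod[OF Q(1) const_in[OF xT] rg] by blast
  then have "smult r g \<in> Q" using Q0[OF xT] x_nonzero by auto
  moreover have "smult r g \<notin> polys_over M"
  proof
    assume "smult r g \<in> polys_over M"
    then have "res (coeff g i) = 0" for i
      using r rT gV by (auto simp: polys_over_def M_def res_mult)
    then show False using g gV by (auto simp: polys_over_def M_def)
  qed
  ultimately show ?thesis by blast
qed

lemma has_dim_poly_same_field:
  assumes KR: "K = qf R" and dim: "has_dim (polys_over R) m"
  shows "has_dim (polys_over T) (Suc m)"
proof -
  obtain Qs where Qs: "prime_chain (polys_over R) Qs" "length Qs = Suc m"
    using dim by (auto simp: has_dim_def)
  from poly_chain_pre(1)[OF Qs(1)] show ?thesis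
  proof (rule has_dimI)
    fix Ps assume "prime_chain (polys_over T) Ps"
    then obtain Ls Hs where LH: "Ps = Ls @ Hs" "prime_chain (polys_over T) Ls" "length Ls \<le> 2"
      "\<And>P. P \<in> set Ls \<Longrightarrow> \<not> polys_over M \<subseteq> P"
      "\<And>P Q. P \<in> set Ls \<Longrightarrow> Q \<in> set Hs \<Longrightarrow> P \<subset> Q"
      "prime_chain (polys_over R) (map ((`) (map_poly res)) Hs)"
      by (rule poly_chain_split) blast
    have Hs: "length Hs \<le> Suc m" using has_dim_bound[OF dim LH(6)] by simp
    show "length Ps \<le> Suc (Suc m)"
    proof (cases "length Ls \<le> 1")
      case False
      then obtain P1 P2 where Ls: "Ls = [P1, P2]"
        using LH(3) by (cases Ls; cases "tl Ls"; cases "tl (tl Ls)") auto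
      then have P12: "prime_in (polys_over T) P1" "prime_in (polys_over T) P2" "P1 \<subset> P2"
        using LH(2) by (auto simp: prime_chain_def)
      have "0 \<in> P1" using P12 ideal_zero prime_ideal by blast
      then have "P2 \<noteq> {0}" using P12 by blast
      moreover have "\<And>c. c \<in> T \<Longrightarrow> [:c:] \<in> P2 \<Longrightarrow> c = 0"
        using upper_to_zero_not_above_M[OF P12(2)] LH(4)[of P2] Ls by simp
      ultimately have "\<not> P2 \<subseteq> polys_over M" using upper_to_zero_not_below_M[OF KR P12(2)] by blast
      then obtain g where g: "g \<in> P2" "g \<notin> polys_over M" by blast
      \<comment> \<open>The images in R[X] of the upper primes contain the residue of g, so the zero ideal of R[X]
        can still be put below them.\<close>
      have "map_poly res g \<noteq> 0"
        using g ideal_mem[OF prime_ideal[OF P12(2)]] unfolding poly_residue_ker[symmetric]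
        by (auto simp: poly_residue.ker_def)
      moreover have "g \<in> Q" if "Q \<in> set Hs" for Q using LH(5)[of P2 Q] that g Ls by auto
      ultimately have "Q \<noteq> {0}" if "Q \<in> set (map ((`) (map_poly res)) Hs)" for Q
        using that by (auto dest!: equalityD1)
      then have "prime_chain (polys_over R) ({0} # map ((`) (map_poly res)) Hs)"
        by (rule prime_chain_zero_Cons[OF subring_polys_over[OF R] LH(6)])
      then have "Suc (length Hs) \<le> Suc m" using has_dim_bound[OF dim] by fastforce
      then show ?thesis using LH(1,3) by simp
    qed (use LH(1) Hs in simp)
  qed (simp add: Qs)
qed

lemma has_dim_poly_transcendental:
  assumes s: "s \<in> K" "\<And>p. p \<in> polys_over R \<Longrightarrow> poly p s = 0 \<Longrightarrow> p = 0"
    and dim: "has_dim (polys_over R) m"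
  shows "has_dim (polys_over T) (Suc (Suc m))"
proof -
  obtain Qs where Qs: "prime_chain (polys_over R) Qs" "length Qs = Suc m"
    using dim by (auto simp: has_dim_def)
  define Q where "Q = {f \<in> polys_over T. poly f s = 0}"
  note TX = subring_polys_over[OF T_ring]
  have sV: "s \<in> V" "res s = s" using s KV by (auto intro: res_K)
  have Q: "prime_in (polys_over T) Q"
    using TX by (auto simp: Q_def prime_in_def ideal_in_def subring_closed)
  have "Q \<subseteq> polys_over M"
  proof
    fix f assume f: "f \<in> Q"
    then have fT: "f \<in> polys_over T" and fV: "f \<in> polys_over V"
      using polys_over_mono[OF T_subset_V] by (auto simp: Q_def)
    have "poly (map_poly res f) s = 0"
      using res_poly[OF fV sV(1)] f sV res_zero by (simp add: Q_def)
    then have "map_poly res f = 0" using s(2) poly_residue.h_in[OF fT] by blast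
    then show "f \<in> polys_over M" using fT by (simp flip: poly_residue_ker add: poly_residue.ker_def)
  qed
  moreover have xM: "[:x:] \<in> polys_over M"
    using x_in_M V by (simp add: pCons_in_polys_over zero_in_polys_over M_def res_zero subring_zero)
  moreover have "[:x:] \<notin> Q" using x_nonzero by (simp add: Q_def)
  ultimately have "Q \<subset> polys_over M" by blast
  then have below: "Q \<subset> P" if "P \<in> set (map poly_residue.pre Qs)" for P
    using poly_chain_pre(2)[OF Qs(1) that] by blast
  \<comment> \<open>The linear polynomial x (X - s) has its coefficients in M, although s need not be in T.\<close>
  have "[:- (x * s), x:] \<in> Q"
  proof -
    have "x * s \<in> M" using M_mult[OF x_in_M sV(1)] by (simp add: mult.commute)
    then have "- (x * s) \<in> T" "x \<in> T" "0 \<in> T"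
      using M_subset_T x_in_M T_ring by (auto intro: subring_uminus subring_zero)
    then show ?thesis by (simp add: Q_def pCons_in_polys_over zero_in_polys_over algebra_simps)
  qed
  then have "Q \<noteq> {0}" using x_nonzero by auto
  have "prime_chain (polys_over T) (Q # map poly_residue.pre Qs)"
    using poly_chain_pre(1)[OF Qs(1)] below Q by (auto simp: prime_chain_def)
  then have "prime_chain (polys_over T) ({0} # Q # map poly_residue.pre Qs)"
    by (rule prime_chain_zero_Cons[OF TX])
      (use \<open>Q \<noteq> {0}\<close> poly_chain_pre(1)[OF Qs(1)] in \<open>auto simp: prime_chain_def\<close>)
  then show ?thesis
  proof (rule has_dimI)
    fix Ps assume "prime_chain (polys_over T) Ps"
    then obtain Ls Hs where "Ps = Ls @ Hs" "length Ls \<le> 2"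
      "prime_chain (polys_over R) (map ((`) (map_poly res)) Hs)"
      by (rule poly_chain_split) blast
    then show "length Ps \<le> Suc (Suc (Suc m))" using has_dim_bound[OF dim] by fastforce
  qed (simp add: Qs)
qed

end

section \<open>The operations w and w[X]\<close>

lemma submodule_iff_ideal: "A \<subseteq> R \<Longrightarrow> is_submodule R A \<longleftrightarrow> ideal_in R A"
  by (auto simp: is_submodule_def ideal_in_def)

lemma unit_ideal_fg:
  assumes R: "subring_set R"
  shows "R \<in> fg_frac_ideals R" and "v_op R R = R"
proof -
  have "is_submodule R R" using R by (simp add: is_submodule_def subring_closed)
  moreover have "R \<noteq> {0}" using subring_one[OF R] by auto
  ultimately have "R \<in> frac_ideals R"
    using R subset_qf[OF R] by (auto simp: frac_ideals_def subring_one intro!: bexI[of _ 1])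
  moreover have "R = {(\<Sum>s\<in>{1}. c s * s) | c. \<forall>s\<in>{1}. c s \<in> R}"
    by (auto intro!: exI[of _ "\<lambda>_. _"])
  ultimately show "R \<in> fg_frac_ideals R" unfolding fg_frac_ideals_def by blast
  have "ideal_inv R R = R"
    using R subset_qf[OF R] by (fastforce simp: ideal_inv_def subring_mult dest: subring_one)
  then show "v_op R R = R" by (simp add: v_op_def)
qed

lemma w_op_ideal:
  assumes R: "subring_set R" and inv: "nontrivial_inverses R" and A: "ideal_in R A"
  shows "w_op R A = A"
proof
  show "A \<subseteq> w_op R A"
    using unit_ideal_fg[OF R] ideal_mult_right[OF A] ideal_mem[OF A] subset_qf[OF R]
    by (auto simp: w_op_def intro!: exI[of _ R])
  show "w_op R A \<subseteq> A"
  proof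
    fix y assume "y \<in> w_op R A"
    then obtain J where J: "J \<subseteq> R" "J \<in> fg_frac_ideals R" "v_op R J = R" "\<And>j. j \<in> J \<Longrightarrow> y * j \<in> A"
      by (auto simp: w_op_def)
    have "ideal_in R J" "J \<noteq> {0}"
      using J submodule_iff_ideal[OF J(1)] by (auto simp: fg_frac_ideals_def frac_ideals_def)
    \<comment> \<open>An element of the inverse of J is multiplied into R by the v-closure of J, in particular by 1.\<close>
    moreover have False if z: "z \<in> qf R - R" "\<forall>a\<in>J. z * a \<in> R" for z
    proof -
      have "z \<in> ideal_inv R J" using z by (simp add: ideal_inv_def)
      moreover have "1 \<in> ideal_inv R (ideal_inv R J)" using J(3) R by (simp add: v_op_def subring_one)
      ultimately have "1 * z \<in> R" unfolding ideal_inv_def[of R "ideal_inv R J"] by blast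
      then show False using z by simp
    qed
    ultimately have "1 \<in> J" using inv unfolding nontrivial_inverses_def by blast
    then show "y \<in> A" using J(4)[of 1] by simp
  qed
qed

lemma embedding_surjection:
  assumes "subring_set R"
  shows "ring_surjection (polys_over R) (poly_ring R) to_fract"
proof
  show PX: "subring_set (polys_over R)" using assms by (rule subring_polys_over)
  show "subring_set (poly_ring R)"
    unfolding poly_ring_def subring_set_def[of "to_fract ` polys_over R"]
    using PX by (auto simp: subring_closed simp flip: to_fract_1 to_fract_diff to_fract_mult)
qed (auto simp: poly_ring_def)

text \<open>
  If \<open>y\<close> belongs to the closure of \<open>Q\<close>, some \<open>s\<close> in the multiplicative set has all its coefficients in
  the ideal \<open>I\<close> of those \<open>r\<close> with \<open>y * r \<in> Q\<close>. A proper \<open>I\<close> would lie in a prime, which belongs to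
  \<open>Theta_w R\<close> because its contraction is a \<open>w\<close>-ideal, and \<open>s\<close> avoids exactly such primes.
\<close>
lemma wX_op_prime:
  assumes R: "subring_set R" and inv: "nontrivial_inverses R"
    and Q: "prime_in (poly_ring R) Q"
  shows "wX_op R Q = Q"
proof -
  interpret ring_surjection "polys_over R" "poly_ring R" to_fract by (rule embedding_surjection[OF R])
  have const: "to_fract [:r:] \<in> poly_ring R" if "r \<in> R" for r
    using that R by (auto simp: poly_ring_def pCons_in_polys_over zero_in_polys_over subring_zero)
  have Theta: "P \<in> Theta_w R" if P: "prime_in (poly_ring R) P" for P
  proof -
    note Pi = prime_ideal[OF P]
    have "to_fract [:r + t:] = to_fract [:r:] + to_fract [:t:]"
      "to_fract [:r * t:] = to_fract [:r:] * to_fract [:t:]" for r t :: 'a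
      by (simp_all add: mult.commute flip: to_fract_add to_fract_mult)
    then have "ideal_in R (contraction R P)"
      using R ideal_add[OF Pi] ideal_mult[OF Pi const] ideal_zero[OF Pi]
      unfolding ideal_in_def contraction_def
      by (auto simp: subring_closed)
    moreover have "1 \<notin> contraction R P"
      using prime_proper[OF P] by (simp add: contraction_def flip: one_pCons)
    ultimately have "w_op R (contraction R P) \<subset> R"
      using w_op_ideal[OF R inv] subring_one[OF R] by (auto dest: ideal_subset)
    moreover have "P \<in> prime_spectrum (poly_ring R)"
      using P B by (simp add: prime_spectrum_iff is_subring_iff)
    ultimately show ?thesis by (simp add: Theta_w_def)
  qed
  show ?thesis
  proof
    show "Q \<subseteq> wX_op R Q"
    proof
      fix q assume q: "q \<in> Q"
      have "1 \<in> polys_over (poly_ring R)" using subring_polys_over[OF B] by (rule subring_one)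
      moreover have "1 \<notin> P" if "prime_in (poly_ring R) P" for P using prime_proper[OF that] .
      then have "1 \<notin> polys_over P" if "P \<in> Theta_w R" for P
        using that B by (auto simp: Theta_w_def prime_spectrum_iff is_subring_iff one_pCons pCons_in_polys_over)
      ultimately have "1 \<in> S_w R" by (auto simp: S_w_def)
      moreover have "[:q:] \<in> polys_over Q"
        using q ideal_zero[OF prime_ideal[OF Q]] by (simp add: pCons_in_polys_over zero_in_polys_over)
      moreover have "to_fract [:q:] = to_fract [:q:] / to_fract 1" by simp
      moreover have "q \<in> qf (poly_ring R)"
        using ideal_mem[OF prime_ideal[OF Q] q] subset_qf[OF B] by blast
      ultimately show "q \<in> wX_op R Q" unfolding wX_op_def localize_def by blast
    qed
    show "wX_op R Q \<subseteq> Q"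
    proof
      fix y assume "y \<in> wX_op R Q"
      then obtain f s where f: "f \<in> polys_over Q" and s: "s \<in> S_w R"
        and eq: "to_fract [:y:] = to_fract f / to_fract s"
        by (auto simp: wX_op_def localize_def)
      have sR: "coeff s i \<in> poly_ring R" for i using s by (simp add: S_w_def polys_over_def)
      have "s \<noteq> 0"
        using s Theta[OF Q] ideal_zero[OF prime_ideal[OF Q]] by (auto simp: S_w_def zero_in_polys_over)
      then have "to_fract [:y:] * to_fract s = to_fract f" using eq by simp
      then have sf: "smult y s = f" by (simp flip: to_fract_mult)
      define I where "I = {r \<in> poly_ring R. y * r \<in> Q}"
      have "y * coeff s i \<in> Q" for i using f sf by (auto simp: polys_over_def)
      then have sI: "s \<in> polys_over I" using sR by (simp add: polys_over_def I_def)
      have "ideal_in (poly_ring R) I"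
        using prime_ideal[OF Q] B unfolding I_def ideal_in_def
        by (auto simp: subring_closed distrib_left mult.left_commute)
      moreover have "\<not> (prime_in (poly_ring R) P \<and> I \<subseteq> P)" for P
        using Theta[of P] s sI polys_over_mono[of I P] by (auto simp: S_w_def)
      ultimately have "1 \<in> I" using exists_prime_above[OF B] by blast
      then show "y \<in> Q" by (simp add: I_def)
    qed
  qed
qed

lemma star_dim_eq:
  assumes R: "subring_set R" and dim: "has_dim R d"
    and star: "\<And>P. prime_in R P \<Longrightarrow> star P = P"
  shows "star_dim star R = enat d"
proof -
  have sp: "star_primes star R = {P. prime_in R P \<and> P \<noteq> {0}}"
    using star R by (auto simp: star_primes_def prime_spectrum_iff is_subring_iff)
  show ?thesis
    unfolding star_dim_def
  proof (rule antisym)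
    show "Sup {enat (length Ps) | Ps. set Ps \<subseteq> star_primes star R \<and> sorted_wrt (\<subset>) Ps} \<le> enat d"
    proof (rule Sup_least, clarify)
      fix Ps assume "set Ps \<subseteq> star_primes star R" "sorted_wrt (\<subset>) Ps"
      then have "prime_chain R ({0} # Ps)"
        using R unfolding sp by (intro prime_chain_zero_Cons) (auto simp: prime_chain_def)
      then show "enat (length Ps) \<le> enat d" using has_dim_bound[OF dim] by fastforce
    qed
    obtain Ps where "prime_chain R Ps" "length Ps = Suc d" using dim by (auto simp: has_dim_def)
    then obtain P Qs where PQ: "prime_chain R (P # Qs)" "length Qs = d" by (cases Ps) auto
    have "Q \<noteq> {0}" if "Q \<in> set Qs" for Q
    proof -
      have "P \<subset> Q" "0 \<in> P" using that PQ by (auto simp: prime_chain_def dest: prime_ideal ideal_zero)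
      then show ?thesis by blast
    qed
    then have "set Qs \<subseteq> star_primes star R" "sorted_wrt (\<subset>) Qs"
      using PQ unfolding sp by (auto simp: prime_chain_def)
    then show "enat d \<le> Sup {enat (length Ps) | Ps. set Ps \<subseteq> star_primes star R \<and> sorted_wrt (\<subset>) Ps}"
      using PQ(2) by (intro Sup_upper) blast
  qed
qed

section \<open>Realising the dimensions\<close>

text \<open>
  The induction hypothesis of the construction; countability leaves room for the next transcendental
  element.
\<close>
definition realises :: "complex set \<Rightarrow> nat \<Rightarrow> nat \<Rightarrow> bool" where
  "realises R n m \<longleftrightarrow> subring_set R \<and> countable R \<and> integrally_closed R \<and> nontrivial_inverses R \<and>
     has_dim R n \<and> has_dim (polys_over R) m"

lemma realises_Rats: "realises \<rat> 0 1"
proof -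
  have sub: "subring_set (\<rat> :: complex set)" by (simp add: subring_set_def)
  note PX = subring_polys_over[OF sub]
  have inv: "1 \<in> I" if "ideal_in \<rat> I" "r \<in> I" "r \<noteq> 0" for I and r :: complex
    using ideal_mult[of \<rat> I "inverse r" r] that by (auto dest: ideal_mem)
  have zero: "P = {0}" if "prime_in \<rat> P" for P :: "complex set"
    using that inv[of P] by (auto dest: prime_ideal prime_proper ideal_zero)
  have "qf (\<rat> :: complex set) \<subseteq> \<rat>" by (auto simp: qf_def)
  then have "integrally_closed (\<rat> :: complex set)" by (auto simp: integrally_closed_def)
  moreover have "nontrivial_inverses (\<rat> :: complex set)"
    unfolding nontrivial_inverses_def using inv ideal_zero by blast
  moreover have "has_dim (\<rat> :: complex set) 0"
  proof (rule has_dimI)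
    show "prime_chain \<rat> [{0 :: complex}]" using prime_zero[OF sub] by (simp add: prime_chain_def)
    show "length Ps \<le> Suc 0" if "prime_chain \<rat> Ps" for Ps :: "complex set list"
      using that zero sorted_psubset_const[of Ps "{0}"] by (auto simp: prime_chain_def)
  qed simp
  moreover have "has_dim (polys_over (\<rat> :: complex set)) 1"
  proof (rule has_dimI)
    let ?P = "{p \<in> polys_over (\<rat> :: complex set). poly p 0 = 0}"
    have P: "prime_in (polys_over \<rat>) ?P"
      using PX by (auto simp: prime_in_def ideal_in_def subring_closed)
    have "[:0, 1:] \<in> ?P" by (simp add: pCons_in_polys_over zero_in_polys_over)
    moreover have "[:0, 1:] \<notin> {0 :: complex poly}" by simp
    ultimately have "?P \<noteq> {0}" by metis
    then show "prime_chain (polys_over \<rat>) [{0}, ?P]"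
      using P by (intro prime_chain_zero_Cons[OF PX]) (auto simp: prime_chain_def)
    fix Ps assume Ps: "prime_chain (polys_over (\<rat> :: complex set)) Ps"
    have "c = 0" if "P \<in> set Ps" "c \<in> \<rat>" "[:c:] \<in> P" for P c
    proof (rule ccontr)
      assume "c \<noteq> 0"
      have P: "prime_in (polys_over \<rat>) P" using Ps that by (simp add: prime_chain_def)
      have "[:inverse c:] * [:c:] \<in> P"
        using that by (intro ideal_mult[OF prime_ideal[OF P]]) (auto simp: pCons_in_polys_over zero_in_polys_over)
      then show False using prime_proper[OF P] \<open>c \<noteq> 0\<close> by (simp flip: one_pCons)
    qed
    then show "length Ps \<le> Suc 1" using uppers_chain_length[OF sub Ps] by simp
  qed simp
  ultimately show ?thesis using sub countable_rat by (simp add: realises_def)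
qed

lemma realises_same_field:
  assumes "realises R n m"
  shows "\<exists>R'. realises R' (Suc n) (Suc m)"
proof -
  have base: "subring_set R" "countable R" "integrally_closed R" "nontrivial_inverses R"
    "has_dim R n" "has_dim (polys_over R) m"
    using assms by (auto simp: realises_def)
  obtain V res x where "coefficient_dvr (qf R) V res x" "countable V"
    using exists_coefficient_dvr[OF subfield_qf[OF base(1)] countable_qf[OF base(2)]] by blast
  then interpret coefficient_dvr "qf R" V res x by simp
  interpret pullback "qf R" V res x R by unfold_locales (use base(1) subset_qf[OF base(1)] in auto)
  have "integrally_closed T" using integrally_closedD[OF base(3)] by (rule integrally_closed_pullback)
  moreover have "countable T" using T_subset_V \<open>countable V\<close> by (rule countable_subset)
  ultimately have "realises T (Suc n) (Suc m)"
    using T_ring base nontrivial_inverses_pullback has_dim_pullback has_dim_poly_same_field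
    by (simp add: realises_def)
  then show ?thesis ..
qed

text \<open>
  The auxiliary valuation ring \<open>W\<close> supplies its quotient field: it contains the transcendental
  element \<open>s\<close>, and the quotient field of \<open>R\<close> is algebraically closed in it.
\<close>
lemma realises_transcendental:
  assumes "realises R n m"
  shows "\<exists>R'. realises R' (Suc n) (Suc (Suc m))"
proof -
  have base: "subring_set R" "countable R" "integrally_closed R" "nontrivial_inverses R"
    "has_dim R n" "has_dim (polys_over R) m"
    using assms by (auto simp: realises_def)
  obtain W res\<^sub>0 s where "coefficient_dvr (qf R) W res\<^sub>0 s" "countable W"
    using exists_coefficient_dvr[OF subfield_qf[OF base(1)] countable_qf[OF base(2)]] by blast
  then interpret W: coefficient_dvr "qf R" W res\<^sub>0 s by simp
  have RW: "R \<subseteq> qf W" and sW: "s \<in> qf W"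
    using subset_qf[OF base(1)] W.KV subset_qf[OF W.V] W.x_in by blast+
  obtain V res x where "coefficient_dvr (qf W) V res x" "countable V"
    using exists_coefficient_dvr[OF subfield_qf[OF W.V] countable_qf[OF \<open>countable W\<close>]] by blast
  then interpret coefficient_dvr "qf W" V res x by simp
  interpret pullback "qf W" V res x R by unfold_locales (use base(1) RW in auto)
  have RX: "p \<in> polys_over (qf R)" if "p \<in> polys_over R" for p
    using that polys_over_mono[OF subset_qf[OF base(1)]] by blast
  have "integrally_closed T"
  proof (rule integrally_closed_pullback)
    fix c p assume cp: "c \<in> qf W" "p \<in> polys_over R" "lead_coeff p = 1" "poly p c = 0"
    have "c \<in> qf R" using W.algebraic_in_K[OF cp(1) RX[OF cp(2)] cp(3,4)] .
    then show "c \<in> R" using integrally_closedD[OF base(3)] cp by blast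
  qed
  moreover have "p = 0" if "p \<in> polys_over R" "poly p s = 0" for p
    using W.maximal_ideal_transcendental[OF W.x_in W.res_x W.x_nonzero RX[OF that(1)] that(2)] .
  then have "has_dim (polys_over T) (Suc (Suc m))" using sW base(6) by (intro has_dim_poly_transcendental)
  moreover have "countable T" using T_subset_V \<open>countable V\<close> by (rule countable_subset)
  ultimately have "realises T (Suc n) (Suc (Suc m))"
    using T_ring base nontrivial_inverses_pullback has_dim_pullback by (simp add: realises_def)
  then show ?thesis ..
qed

lemma exists_realisation: "j \<le> n \<Longrightarrow> \<exists>R. realises R n (n + 1 + j)"
proof (induction n arbitrary: j)
  case 0
  then show ?case using realises_Rats by auto
next
  case (Suc n)
  show ?case
  proof (cases "j \<le> n")
    case True
    then show ?thesis using Suc.IH[of j] realises_same_field by fastforce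
  next
    case False
    then have "j = Suc n" using Suc.prems by simp
    then show ?thesis using Suc.IH[of n] realises_transcendental by fastforce
  qed
qed

theorem corollary4p3:
  fixes n m :: nat
  assumes "0 < n" and "0 < m" and "n + 1 \<le> m" and "m \<le> 2 * n + 1"
  shows "\<exists>R :: complex set. is_subring R \<and> integrally_closed R \<and>
           star_dim (w_op R) R = enat n \<and>
           star_dim (wX_op R) (poly_ring R) = enat m"
proof -
  have "m - (n + 1) \<le> n" "n + 1 + (m - (n + 1)) = m" using assms by simp_all
  then obtain R where "realises R n m" using exists_realisation by metis
  then have R: "subring_set R" "integrally_closed R" "nontrivial_inverses R"
    "has_dim R n" "has_dim (polys_over R) m"
    by (auto simp: realises_def)
  have emb: "ring_surjection (polys_over R) (poly_ring R) to_fract"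
    by (rule embedding_surjection[OF R(1)])
  have "star_dim (w_op R) R = enat n"
    using R by (intro star_dim_eq) (simp_all add: w_op_ideal prime_ideal)
  moreover have "has_dim (poly_ring R) m"
    using has_dim_iso[OF emb _ R(5)] by (simp add: inj_on_def)
  then have "star_dim (wX_op R) (poly_ring R) = enat m"
    using R wX_op_prime ring_surjection.B[OF emb] by (intro star_dim_eq)
  ultimately show ?thesis using R by (auto simp: is_subring_iff)
qed

end
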